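(* Let $\mathcal{D}$ be a triangulated category with shift functor $\Sigma$. For $i=1,2$, let $(\mathcal{U}_i,\mathcal{V}_i)$ be a $t$-structure on $\mathcal{D}$, with $\mathcal{U}_1\subseteq\mathcal{U}_2$, and let $\mathcal{H}:=\mathcal{U}_2\cap\mathcal{V}_1$. Then there exist mutually inverse isomorphisms of posets $$\Phi:\mathsf{t\text{-}str}[(\mathcal{U}_1,\mathcal{V}_1),(\mathcal{U}_2,\mathcal{V}_2)]\longrightarrow\mathsf{stors}\,\mathcal{H},\qquad\Psi:\mathsf{stors}\,\mathcal{H}\longrightarrow\mathsf{t\text{-}str}[(\mathcal{U}_1,\mathcal{V}_1),(\mathcal{U}_2,\mathcal{V}_2)],$$ where $\Phi(\mathcal{T},\mathcal{F}):=(\mathcal{T}\cap\mathcal{V}_1,\ \mathcal{U}_2\cap\mathcal{F})$ and $\Psi(\mathcal{X},\mathcal{Y}):=(\mathcal{U}_1\ast\mathcal{X},\ \mathcal{Y}\ast\mathcal{V}_2)$. In addition, if $\Sigma\mathcal{U}_2\subseteq\mathcal{U}_1$ holds, then $\mathcal{H}$ becomes an exact category by the induced extriangulated structure, and $\mathsf{stors}\,\mathcal{H}=\mathsf{tors}\,\mathcal{H}$.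
   Context: All categories are skeletally small; all subcategories are full and closed under isomorphisms. For subcategories $\mathcal{X},\mathcal{Y}$ of $\mathcal{D}$, $\mathcal{X}\ast\mathcal{Y}$ is the subcategory of objects $M\in\mathcal{D}$ admitting a triangle $X\to M\to Y\to\Sigma X$ with $X\in\mathcal{X}$, $Y\in\mathcal{Y}$. A $t$-structure on $\mathcal{D}$ is a pair $(\mathcal{U},\mathcal{V})$ of subcategories with $\mathcal{D}=\mathcal{U}\ast\mathcal{V}$, $\mathcal{D}(\mathcal{U},\mathcal{V})=0$ and $\Sigma\mathcal{U}\subseteq\mathcal{U}$. $\mathsf{t\text{-}str}[(\mathcal{U}_1,\mathcal{V}_1),(\mathcal{U}_2,\mathcal{V}_2)]$ is the set of $t$-structures $(\mathcal{U},\mathcal{V})$ on $\mathcal{D}$ with $\mathcal{U}_1\subseteq\mathcal{U}\subseteq\mathcal{U}_2$, ordered by inclusion of the first components. $\mathcal{H}$ is extension-closed in $\mathcal{D}$ ($\mathcal{H}\ast\mathcal{H}\subseteq\mathcal{H}$) and carries the induced extriangulated structure $\mathbb{E}(C,A)=\mathcal{D}(C,\Sigma A)$, whose conflations are the sequences $A\to B\to C$ in $\mathcal{H}$ that extend to triangles $A\to B\to C\to\Sigma A$ in $\mathcal{D}$, and the negative first extension $\mathbb{E}^{-1}(C,A)=\mathcal{D}(C,\Sigma^{-1}A)$. An $s$-torsion pair in $\mathcal{H}$ is a pair $(\mathcal{X},\mathcal{Y})$ of subcategories of $\mathcal{H}$ such that every $H\in\mathcal{H}$ admits a triangle $X\to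 H\to Y\to\Sigma X$ with $X\in\mathcal{X}$, $Y\in\mathcal{Y}$ (i.e. $\mathcal{H}=\mathcal{X}\ast\mathcal{Y}$), $\mathcal{D}(\mathcal{X},\mathcal{Y})=0$ and $\mathcal{D}(\mathcal{X},\Sigma^{-1}\mathcal{Y})=0$. $\mathsf{stors}\,\mathcal{H}$ is the set of these, ordered by inclusion of the first components. "$\mathcal{H}$ becomes an exact category by the induced extriangulated structure" means that the conflations just described define a Quillen exact structure on $\mathcal{H}$. For an exact category $\mathcal{E}$, a torsion pair is a pair $(\mathcal{T},\mathcal{F})$ of subcategories such that every $E\in\mathcal{E}$ admits a conflation $0\to T\to E\to F\to0$ with $T\in\mathcal{T}$, $F\in\mathcal{F}$, and $\mathcal{E}(\mathcal{T},\mathcal{F})=0$; $\mathsf{tors}\,\mathcal{E}$ is the poset of torsion pairs, ordered by inclusion of first components. *)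

theory Defs
  imports "HOL-Algebra.Group"
begin

section \<open>Categories\<close>

record ('o, 'm) cat =
  obj :: "'o set"
  arr :: "'m set"
  src :: "'m \<Rightarrow> 'o"
  tgt :: "'m \<Rightarrow> 'o"
  idn :: "'o \<Rightarrow> 'm"
  compose :: "'m \<Rightarrow> 'm \<Rightarrow> 'm" (infixl "\<cdot>\<index>" 70)

definition Hom :: "('o, 'm, 'x) cat_scheme \<Rightarrow> 'o \<Rightarrow> 'o \<Rightarrow> 'm set" where
  "Hom C A B = {f \<in> arr C. src C f = A \<and> tgt C f = B}"

locale category =
  fixes C :: "('o, 'm, 'x) cat_scheme" (structure)
  assumes src_obj: "f \<in> arr C \<Longrightarrow> src C f \<in> obj C"
    and tgt_obj: "f \<in> arr C \<Longrightarrow> tgt C f \<in> obj C"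
    and idn_hom: "A \<in> obj C \<Longrightarrow> idn C A \<in> Hom C A A"
    and compose_hom: "\<lbrakk>f \<in> Hom C X Y; g \<in> Hom C Y Z\<rbrakk> \<Longrightarrow> g \<cdot> f \<in> Hom C X Z"
    and idn_right: "f \<in> arr C \<Longrightarrow> f \<cdot> idn C (src C f) = f"
    and idn_left: "f \<in> arr C \<Longrightarrow> idn C (tgt C f) \<cdot> f = f"
    and compose_assoc:
      "\<lbrakk>f \<in> Hom C W X; g \<in> Hom C X Y; h \<in> Hom C Y Z\<rbrakk> \<Longrightarrow> (h \<cdot> g) \<cdot> f = h \<cdot> (g \<cdot> f)"

definition is_iso :: "('o, 'm, 'x) cat_scheme \<Rightarrow> 'm \<Rightarrow> bool" where
  "is_iso C f \<longleftrightarrow> f \<in> arr C \<and>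
     (\<exists>g \<in> Hom C (tgt C f) (src C f).
        g \<cdot>\<^bsub>C\<^esub> f = idn C (src C f) \<and> f \<cdot>\<^bsub>C\<^esub> g = idn C (tgt C f))"

text \<open>Subcategories are full and closed under isomorphisms, hence given by a class of objects.\<close>

definition is_subcategory :: "('o, 'm, 'x) cat_scheme \<Rightarrow> 'o set \<Rightarrow> bool" where
  "is_subcategory C X \<longleftrightarrow> X \<subseteq> obj C \<and>
     (\<forall>f. is_iso C f \<and> src C f \<in> X \<longrightarrow> tgt C f \<in> X)"

definition is_zero_object :: "('o, 'm, 'x) cat_scheme \<Rightarrow> 'o \<Rightarrow> bool" where
  "is_zero_object C Z \<longleftrightarrow> Z \<in> obj C \<and>
     (\<forall>A \<in> obj C. (\<exists>!f. f \<in> Hom C A Z) \<and> (\<exists>!f. f \<in> Hom C Z A))"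

definition is_functor ::
  "('o, 'm, 'x) cat_scheme \<Rightarrow> ('p, 'n, 'y) cat_scheme \<Rightarrow> ('o \<Rightarrow> 'p) \<Rightarrow> ('m \<Rightarrow> 'n) \<Rightarrow> bool" where
  "is_functor C D Fo Fa \<longleftrightarrow>
     (\<forall>A \<in> obj C. Fo A \<in> obj D) \<and>
     (\<forall>f \<in> arr C. Fa f \<in> Hom D (Fo (src C f)) (Fo (tgt C f))) \<and>
     (\<forall>A \<in> obj C. Fa (idn C A) = idn D (Fo A)) \<and>
     (\<forall>f \<in> arr C. \<forall>g \<in> arr C. tgt C f = src C g \<longrightarrow> Fa (g \<cdot>\<^bsub>C\<^esub> f) = Fa g \<cdot>\<^bsub>D\<^esub> Fa f)"

definition naturally_isomorphic ::
  "('o, 'm, 'x) cat_scheme \<Rightarrow> ('p, 'n, 'y) cat_scheme \<Rightarrow>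
   ('o \<Rightarrow> 'p) \<Rightarrow> ('m \<Rightarrow> 'n) \<Rightarrow> ('o \<Rightarrow> 'p) \<Rightarrow> ('m \<Rightarrow> 'n) \<Rightarrow> bool" where
  "naturally_isomorphic C D Fo Fa Go Ga \<longleftrightarrow>
     (\<exists>\<tau>. (\<forall>A \<in> obj C. \<tau> A \<in> Hom D (Fo A) (Go A) \<and> is_iso D (\<tau> A)) \<and>
          (\<forall>f \<in> arr C. \<tau> (tgt C f) \<cdot>\<^bsub>D\<^esub> Fa f = Ga f \<cdot>\<^bsub>D\<^esub> \<tau> (src C f)))"

section \<open>Additive categories\<close>

record ('o, 'm) preadditive_cat = "('o, 'm) cat" +
  add_arr :: "'m \<Rightarrow> 'm \<Rightarrow> 'm"
  zero_arr :: "'o \<Rightarrow> 'o \<Rightarrow> 'm"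

text \<open>The abelian group of morphisms between two objects, in the multiplicative notation of
  the group library.\<close>

definition hom_group ::
  "('o, 'm, 'x) preadditive_cat_scheme \<Rightarrow> 'o \<Rightarrow> 'o \<Rightarrow> 'm monoid" where
  "hom_group C A B = \<lparr>carrier = Hom C A B, mult = add_arr C, one = zero_arr C A B\<rparr>"

definition neg_arr :: "('o, 'm, 'x) preadditive_cat_scheme \<Rightarrow> 'm \<Rightarrow> 'm" where
  "neg_arr C f = inv\<^bsub>hom_group C (src C f) (tgt C f)\<^esub> f"

text \<open>\<open>C(X, Y) = 0\<close> for classes of objects \<open>X\<close> and \<open>Y\<close>.\<close>

definition hom_vanishes ::
  "('o, 'm, 'x) preadditive_cat_scheme \<Rightarrow> 'o set \<Rightarrow> 'o set \<Rightarrow> bool" where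
  "hom_vanishes C X Y \<longleftrightarrow> (\<forall>A \<in> X. \<forall>B \<in> Y. Hom C A B = {zero_arr C A B})"

definition is_biproduct ::
  "('o, 'm, 'x) preadditive_cat_scheme \<Rightarrow> 'o \<Rightarrow> 'o \<Rightarrow> 'o \<Rightarrow> 'm \<Rightarrow> 'm \<Rightarrow> 'm \<Rightarrow> 'm \<Rightarrow> bool" where
  "is_biproduct C A B P i j p q \<longleftrightarrow> P \<in> obj C \<and>
     i \<in> Hom C A P \<and> j \<in> Hom C B P \<and> p \<in> Hom C P A \<and> q \<in> Hom C P B \<and>
     p \<cdot>\<^bsub>C\<^esub> i = idn C A \<and> q \<cdot>\<^bsub>C\<^esub> j = idn C B \<and>
     q \<cdot>\<^bsub>C\<^esub> i = zero_arr C A B \<and> p \<cdot>\<^bsub>C\<^esub> j = zero_arr C B A \<and>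
     add_arr C (i \<cdot>\<^bsub>C\<^esub> p) (j \<cdot>\<^bsub>C\<^esub> q) = idn C P"

locale additive_category = category C for C :: "('o, 'm, 'x) preadditive_cat_scheme" (structure) +
  assumes hom_group: "\<lbrakk>A \<in> obj C; B \<in> obj C\<rbrakk> \<Longrightarrow> comm_group (hom_group C A B)"
    and compose_add_right:
      "\<lbrakk>f \<in> Hom C X Y; f' \<in> Hom C X Y; g \<in> Hom C Y Z\<rbrakk>
        \<Longrightarrow> g \<cdot> add_arr C f f' = add_arr C (g \<cdot> f) (g \<cdot> f')"
    and compose_add_left:
      "\<lbrakk>f \<in> Hom C X Y; g \<in> Hom C Y Z; g' \<in> Hom C Y Z\<rbrakk>
        \<Longrightarrow> add_arr C g g' \<cdot> f = add_arr C (g \<cdot> f) (g' \<cdot> f)"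
    and zero_object: "\<exists>Z. is_zero_object C Z"
    and biproducts: "\<lbrakk>A \<in> obj C; B \<in> obj C\<rbrakk> \<Longrightarrow> \<exists>P i j p q. is_biproduct C A B P i j p q"

definition is_additive_functor ::
  "('o, 'm, 'x) preadditive_cat_scheme \<Rightarrow> ('p, 'n, 'y) preadditive_cat_scheme \<Rightarrow>
   ('o \<Rightarrow> 'p) \<Rightarrow> ('m \<Rightarrow> 'n) \<Rightarrow> bool" where
  "is_additive_functor C D Fo Fa \<longleftrightarrow> is_functor C D Fo Fa \<and>
     (\<forall>A \<in> obj C. \<forall>B \<in> obj C. \<forall>f \<in> Hom C A B. \<forall>g \<in> Hom C A B.
        Fa (add_arr C f g) = add_arr D (Fa f) (Fa g))"

definition full_subcat ::
  "('o, 'm, 'x) preadditive_cat_scheme \<Rightarrow> 'o set \<Rightarrow> ('o, 'm) preadditive_cat" where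
  "full_subcat C H =
     \<lparr>obj = H, arr = {f \<in> arr C. src C f \<in> H \<and> tgt C f \<in> H},
      src = src C, tgt = tgt C, idn = idn C, compose = compose C,
      add_arr = add_arr C, zero_arr = zero_arr C\<rparr>"

section \<open>Triangulated categories\<close>

text \<open>The shift is an additive auto-equivalence (not necessarily an automorphism) that comes with a
  quasi-inverse \<open>unshift\<close>. A triple \<open>(f, g, h)\<close> in \<open>triangles\<close> is a distinguished triangle
  \<open>X \<rightarrow> Y \<rightarrow> Z \<rightarrow> \<Sigma>X\<close>, whose objects are the sources and targets of the three morphisms.\<close>

record ('o, 'm) triangulated_cat = "('o, 'm) preadditive_cat" +
  shift_obj :: "'o \<Rightarrow> 'o"
  shift_arr :: "'m \<Rightarrow> 'm"
  unshift_obj :: "'o \<Rightarrow> 'o"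
  unshift_arr :: "'m \<Rightarrow> 'm"
  triangles :: "('m \<times> 'm \<times> 'm) set"

definition is_candidate_triangle ::
  "('o, 'm, 'x) triangulated_cat_scheme \<Rightarrow> 'm \<times> 'm \<times> 'm \<Rightarrow> bool" where
  "is_candidate_triangle D = (\<lambda>(f, g, h).
     f \<in> arr D \<and> g \<in> arr D \<and> h \<in> arr D \<and>
     tgt D f = src D g \<and> tgt D g = src D h \<and> tgt D h = shift_obj D (src D f))"

definition is_triangle_morphism ::
  "('o, 'm, 'x) triangulated_cat_scheme \<Rightarrow>
   'm \<times> 'm \<times> 'm \<Rightarrow> 'm \<times> 'm \<times> 'm \<Rightarrow> 'm \<Rightarrow> 'm \<Rightarrow> 'm \<Rightarrow> bool" where
  "is_triangle_morphism D = (\<lambda>(f, g, h) (f', g', h') a b c.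
     a \<in> Hom D (src D f) (src D f') \<and>
     b \<in> Hom D (src D g) (src D g') \<and>
     c \<in> Hom D (src D h) (src D h') \<and>
     b \<cdot>\<^bsub>D\<^esub> f = f' \<cdot>\<^bsub>D\<^esub> a \<and>
     c \<cdot>\<^bsub>D\<^esub> g = g' \<cdot>\<^bsub>D\<^esub> b \<and>
     shift_arr D a \<cdot>\<^bsub>D\<^esub> h = h' \<cdot>\<^bsub>D\<^esub> c)"

text \<open>The octahedral axiom is stated for \<open>f : X \<rightarrow> Y\<close>, \<open>g : Y \<rightarrow> Z\<close> and chosen triangles
  \<open>X \<rightarrow> Y \<rightarrow> Z' \<rightarrow> \<Sigma>X\<close>, \<open>Y \<rightarrow> Z \<rightarrow> X' \<rightarrow> \<Sigma>Y\<close>, \<open>X \<rightarrow> Z \<rightarrow> Y' \<rightarrow> \<Sigma>X\<close> on \<open>f\<close>, \<open>g\<close>, \<open>g f\<close>; it yields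
  a triangle \<open>Z' \<rightarrow> Y' \<rightarrow> X' \<rightarrow> \<Sigma>Z'\<close>.\<close>

locale triangulated_category = additive_category D
  for D :: "('o, 'm, 'x) triangulated_cat_scheme" (structure) +
  assumes shift_functor: "is_additive_functor D D (shift_obj D) (shift_arr D)"
    and unshift_functor: "is_additive_functor D D (unshift_obj D) (unshift_arr D)"
    and unshift_shift: "naturally_isomorphic D D (unshift_obj D \<circ> shift_obj D)
      (unshift_arr D \<circ> shift_arr D) id id"
    and shift_unshift: "naturally_isomorphic D D (shift_obj D \<circ> unshift_obj D)
      (shift_arr D \<circ> unshift_arr D) id id"
    and triangle_candidate: "t \<in> triangles D \<Longrightarrow> is_candidate_triangle D t"
    and triangle_iso:
      "\<lbrakk>t \<in> triangles D; is_candidate_triangle D t'; is_triangle_morphism D t t' a b c;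
        is_iso D a; is_iso D b; is_iso D c\<rbrakk> \<Longrightarrow> t' \<in> triangles D"
    and triangle_idn:
      "\<lbrakk>X \<in> obj D; is_zero_object D Z\<rbrakk>
        \<Longrightarrow> (idn D X, zero_arr D X Z, zero_arr D Z (shift_obj D X)) \<in> triangles D"
    and triangle_exists: "f \<in> arr D \<Longrightarrow> \<exists>g h. (f, g, h) \<in> triangles D"
    and triangle_rotate:
      "is_candidate_triangle D (f, g, h) \<Longrightarrow>
        (f, g, h) \<in> triangles D \<longleftrightarrow> (g, h, neg_arr D (shift_arr D f)) \<in> triangles D"
    and triangle_complete:
      "\<lbrakk>(f, g, h) \<in> triangles D; (f', g', h') \<in> triangles D;
        a \<in> Hom D (src D f) (src D f'); b \<in> Hom D (tgt D f) (tgt D f'); b \<cdot> f = f' \<cdot> a\<rbrakk>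
        \<Longrightarrow> \<exists>c. is_triangle_morphism D (f, g, h) (f', g', h') a b c"
    and octahedral:
      "\<lbrakk>tgt D f = src D g; (f, f', f'') \<in> triangles D; (g, g', g'') \<in> triangles D;
        (g \<cdot> f, h', h'') \<in> triangles D\<rbrakk>
        \<Longrightarrow> \<exists>u v. u \<in> Hom D (tgt D f') (tgt D h') \<and> v \<in> Hom D (tgt D h') (tgt D g') \<and>
              (u, v, shift_arr D f' \<cdot> g'') \<in> triangles D \<and>
              u \<cdot> f' = h' \<cdot> g \<and> h'' \<cdot> u = f'' \<and>
              v \<cdot> h' = g' \<and> g'' \<cdot> v = shift_arr D f \<cdot> h''"

text \<open>The operation \<open>X * Y\<close> on classes of objects.\<close>

definition star ::
  "('o, 'm, 'x) triangulated_cat_scheme \<Rightarrow> 'o set \<Rightarrow> 'o set \<Rightarrow> 'o set" where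
  "star D X Y =
     {M \<in> obj D. \<exists>f g h. (f, g, h) \<in> triangles D \<and> src D f \<in> X \<and> tgt D f = M \<and> tgt D g \<in> Y}"

section \<open>t-structures and s-torsion pairs\<close>

definition t_structure :: "('o, 'm, 'x) triangulated_cat_scheme \<Rightarrow> 'o set \<times> 'o set \<Rightarrow> bool" where
  "t_structure D = (\<lambda>(U, V).
     is_subcategory D U \<and> is_subcategory D V \<and>
     obj D = star D U V \<and> hom_vanishes D U V \<and> shift_obj D ` U \<subseteq> U)"

definition t_str ::
  "('o, 'm, 'x) triangulated_cat_scheme \<Rightarrow> 'o set \<times> 'o set \<Rightarrow> 'o set \<times> 'o set \<Rightarrow>
   ('o set \<times> 'o set) set" where
  "t_str D P Q = {T. t_structure D T \<and> fst P \<subseteq> fst T \<and> fst T \<subseteq> fst Q}"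

text \<open>The inclusion of \<open>X * Y\<close> in \<open>H\<close> is automatic when \<open>H\<close> is extension-closed.\<close>

definition stors ::
  "('o, 'm, 'x) triangulated_cat_scheme \<Rightarrow> 'o set \<Rightarrow> ('o set \<times> 'o set) set" where
  "stors D H = {(X, Y).
     is_subcategory (full_subcat D H) X \<and> is_subcategory (full_subcat D H) Y \<and>
     H = star D X Y \<and> hom_vanishes D X Y \<and> hom_vanishes D X (unshift_obj D ` Y)}"

section \<open>Exact categories and torsion pairs\<close>

definition is_kernel :: "('o, 'm, 'x) preadditive_cat_scheme \<Rightarrow> 'm \<Rightarrow> 'm \<Rightarrow> bool" where
  "is_kernel C i p \<longleftrightarrow> i \<in> arr C \<and> p \<in> arr C \<and> tgt C i = src C p \<and>
     p \<cdot>\<^bsub>C\<^esub> i = zero_arr C (src C i) (tgt C p) \<and>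
     (\<forall>f \<in> arr C. tgt C f = src C p \<and> p \<cdot>\<^bsub>C\<^esub> f = zero_arr C (src C f) (tgt C p) \<longrightarrow>
        (\<exists>!k. k \<in> Hom C (src C f) (src C i) \<and> i \<cdot>\<^bsub>C\<^esub> k = f))"

definition is_cokernel :: "('o, 'm, 'x) preadditive_cat_scheme \<Rightarrow> 'm \<Rightarrow> 'm \<Rightarrow> bool" where
  "is_cokernel C p i \<longleftrightarrow> i \<in> arr C \<and> p \<in> arr C \<and> tgt C i = src C p \<and>
     p \<cdot>\<^bsub>C\<^esub> i = zero_arr C (src C i) (tgt C p) \<and>
     (\<forall>f \<in> arr C. src C f = tgt C i \<and> f \<cdot>\<^bsub>C\<^esub> i = zero_arr C (src C i) (tgt C f) \<longrightarrow>
        (\<exists>!k. k \<in> Hom C (tgt C p) (tgt C f) \<and> k \<cdot>\<^bsub>C\<^esub> p = f))"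

text \<open>\<open>is_pushout C i f i' f'\<close>: the span \<open>A' \<leftarrow> A \<rightarrow> B\<close> given by \<open>f : A \<rightarrow> A'\<close> and \<open>i : A \<rightarrow> B\<close> has
  the pushout \<open>A' \<rightarrow> B' \<leftarrow> B\<close> given by \<open>i' : A' \<rightarrow> B'\<close> and \<open>f' : B \<rightarrow> B'\<close>; pullbacks are dual.\<close>

definition is_pushout ::
  "('o, 'm, 'x) cat_scheme \<Rightarrow> 'm \<Rightarrow> 'm \<Rightarrow> 'm \<Rightarrow> 'm \<Rightarrow> bool" where
  "is_pushout C i f i' f' \<longleftrightarrow>
     i \<in> arr C \<and> f \<in> arr C \<and> i' \<in> arr C \<and> f' \<in> arr C \<and>
     src C i = src C f \<and> src C i' = tgt C f \<and> src C f' = tgt C i \<and> tgt C i' = tgt C f' \<and>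
     i' \<cdot>\<^bsub>C\<^esub> f = f' \<cdot>\<^bsub>C\<^esub> i \<and>
     (\<forall>Q \<in> obj C. \<forall>u \<in> Hom C (tgt C f) Q. \<forall>v \<in> Hom C (tgt C i) Q.
        u \<cdot>\<^bsub>C\<^esub> f = v \<cdot>\<^bsub>C\<^esub> i \<longrightarrow>
        (\<exists>!k. k \<in> Hom C (tgt C i') Q \<and> k \<cdot>\<^bsub>C\<^esub> i' = u \<and> k \<cdot>\<^bsub>C\<^esub> f' = v))"

definition is_pullback ::
  "('o, 'm, 'x) cat_scheme \<Rightarrow> 'm \<Rightarrow> 'm \<Rightarrow> 'm \<Rightarrow> 'm \<Rightarrow> bool" where
  "is_pullback C p f p' f' \<longleftrightarrow>
     p \<in> arr C \<and> f \<in> arr C \<and> p' \<in> arr C \<and> f' \<in> arr C \<and>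
     tgt C p = tgt C f \<and> tgt C p' = src C f \<and> tgt C f' = src C p \<and> src C p' = src C f' \<and>
     f \<cdot>\<^bsub>C\<^esub> p' = p \<cdot>\<^bsub>C\<^esub> f' \<and>
     (\<forall>Q \<in> obj C. \<forall>u \<in> Hom C Q (src C f). \<forall>v \<in> Hom C Q (src C p).
        f \<cdot>\<^bsub>C\<^esub> u = p \<cdot>\<^bsub>C\<^esub> v \<longrightarrow>
        (\<exists>!k. k \<in> Hom C Q (src C p') \<and> p' \<cdot>\<^bsub>C\<^esub> k = u \<and> f' \<cdot>\<^bsub>C\<^esub> k = v))"

definition admissible_monic :: "('m \<times> 'm) set \<Rightarrow> 'm \<Rightarrow> bool" where
  "admissible_monic S i \<longleftrightarrow> (\<exists>p. (i, p) \<in> S)"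

definition admissible_epic :: "('m \<times> 'm) set \<Rightarrow> 'm \<Rightarrow> bool" where
  "admissible_epic S p \<longleftrightarrow> (\<exists>i. (i, p) \<in> S)"

text \<open>Quillen exact categories; \<open>S\<close> is the class of conflations \<open>(i, p)\<close>.\<close>

locale exact_category = additive_category C
  for C :: "('o, 'm, 'x) preadditive_cat_scheme" (structure) +
  fixes S :: "('m \<times> 'm) set"
  assumes kernel_cokernel_pair: "(i, p) \<in> S \<Longrightarrow> is_kernel C i p \<and> is_cokernel C p i"
    and iso_closed:
      "\<lbrakk>(i, p) \<in> S; i' \<in> arr C; p' \<in> arr C; tgt C i' = src C p';
        a \<in> Hom C (src C i) (src C i'); b \<in> Hom C (tgt C i) (tgt C i');
        c \<in> Hom C (tgt C p) (tgt C p');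
        is_iso C a; is_iso C b; is_iso C c;
        b \<cdot> i = i' \<cdot> a; c \<cdot> p = p' \<cdot> b\<rbrakk> \<Longrightarrow> (i', p') \<in> S"
    and idn_monic: "A \<in> obj C \<Longrightarrow> admissible_monic S (idn C A)"
    and idn_epic: "A \<in> obj C \<Longrightarrow> admissible_epic S (idn C A)"
    and compose_monic:
      "\<lbrakk>admissible_monic S i; admissible_monic S j; tgt C i = src C j\<rbrakk>
        \<Longrightarrow> admissible_monic S (j \<cdot> i)"
    and compose_epic:
      "\<lbrakk>admissible_epic S p; admissible_epic S q; tgt C p = src C q\<rbrakk>
        \<Longrightarrow> admissible_epic S (q \<cdot> p)"
    and pushout_monic:
      "\<lbrakk>admissible_monic S i; f \<in> arr C; src C f = src C i\<rbrakk>
        \<Longrightarrow> \<exists>i' f'. is_pushout C i f i' f' \<and> admissible_monic S i'"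
    and pullback_epic:
      "\<lbrakk>admissible_epic S p; f \<in> arr C; tgt C f = tgt C p\<rbrakk>
        \<Longrightarrow> \<exists>p' f'. is_pullback C p f p' f' \<and> admissible_epic S p'"

definition tors ::
  "('o, 'm, 'x) preadditive_cat_scheme \<Rightarrow> ('m \<times> 'm) set \<Rightarrow> ('o set \<times> 'o set) set" where
  "tors C S = {(T, F).
     is_subcategory C T \<and> is_subcategory C F \<and>
     (\<forall>E \<in> obj C. \<exists>i p. (i, p) \<in> S \<and> src C i \<in> T \<and> tgt C i = E \<and> tgt C p \<in> F) \<and>
     hom_vanishes C T F}"

text \<open>The conflations of the extriangulated structure induced on an extension-closed \<open>H\<close>.\<close>

definition conflations ::
  "('o, 'm, 'x) triangulated_cat_scheme \<Rightarrow> 'o set \<Rightarrow> ('m \<times> 'm) set" where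
  "conflations D H = {(f, g). \<exists>h. (f, g, h) \<in> triangles D \<and>
     src D f \<in> H \<and> tgt D f \<in> H \<and> tgt D g \<in> H}"

section \<open>Isomorphisms of posets\<close>

text \<open>\<open>t_str\<close>, \<open>stors\<close> and \<open>tors\<close> are all ordered by inclusion of first components.\<close>

definition fst_order :: "('o set \<times> 'o set) set \<Rightarrow> ('o set \<times> 'o set) rel" where
  "fst_order P = {(p, q). p \<in> P \<and> q \<in> P \<and> fst p \<subseteq> fst q}"

definition inverse_poset_isos ::
  "'a set \<Rightarrow> 'a rel \<Rightarrow> 'b set \<Rightarrow> 'b rel \<Rightarrow> ('a \<Rightarrow> 'b) \<Rightarrow> ('b \<Rightarrow> 'a) \<Rightarrow> bool" where
  "inverse_poset_isos P r Q s \<phi> \<psi> \<longleftrightarrow>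
     partial_order_on P r \<and> partial_order_on Q s \<and>
     \<phi> ` P \<subseteq> Q \<and> \<psi> ` Q \<subseteq> P \<and>
     (\<forall>p \<in> P. \<psi> (\<phi> p) = p) \<and> (\<forall>q \<in> Q. \<phi> (\<psi> q) = q) \<and>
     (\<forall>p p'. (p, p') \<in> r \<longrightarrow> (\<phi> p, \<phi> p') \<in> s) \<and>
     (\<forall>q q'. (q, q') \<in> s \<longrightarrow> (\<psi> q, \<psi> q') \<in> r)"

end

theory Submission
  imports Defs
begin

text \<open>Both halves of a t-structure, and of an s-torsion pair, are the orthogonal of each other:
  if \<open>M\<close> lies in \<open>X * Y\<close>, \<open>D(\<Sigma>X, Y) = 0\<close> and \<open>D(M, Y) = 0\<close>, then the first map of the triangle
  \<open>X \<rightarrow> M \<rightarrow> Y\<close> is an isomorphism. Membership thus reduces to the vanishing of morphisms, and the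
  bijection follows from the associativity of \<open>*\<close> applied to
  \<open>D = U\<^sub>1 * V\<^sub>1 = U\<^sub>1 * (H * V\<^sub>2) = U\<^sub>1 * ((X * Y) * V\<^sub>2)\<close>.
  If \<open>\<Sigma>U\<^sub>2 \<subseteq> U\<^sub>1\<close>, then \<open>D(\<Sigma>H, H) = 0\<close>, so conflations are kernel-cokernel pairs and the second
  vanishing condition on s-torsion pairs is automatic.\<close>

section \<open>Additive categories\<close>

text \<open>The shift is an auto-equivalence whose quasi-inverse is known only up to natural
  isomorphism, so \<Sigma>^-1 is kept out of the arguments. The condition D(X, \<Sigma>^-1 Y) = 0 is
  rewritten as D(\<Sigma>X, Y) = 0, and whatever happens to the left of a triangle is solved one
  shift later and brought back by fullness and faithfulness. The vanishing of D(\<Sigma>X, Y) makes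
  both maps of a triangle X -> M -> Y cancellable: the first on maps from X, the second on maps to
  Y. For a t-structure it follows from \<Sigma>U \<subseteq> U. For an s-torsion pair it is an
  axiom, and it is what makes U1 * X closed under the shift. For the exact structure, the cone of a
  morphism i of H always lies in U2, so i is an admissible monic as soon as the cone is right
  orthogonal to U1. Long exact sequences turn this into injectivity of \<Sigma>i on maps from U1.
  Admissible epics are treated dually, with fibres and V2.\<close>

lemma Hom_iff: "f \<in> Hom C A B \<longleftrightarrow> f \<in> arr C \<and> src C f = A \<and> tgt C f = B"
  by (auto simp: Hom_def)

definition sub_arr :: "('o, 'm, 'x) preadditive_cat_scheme \<Rightarrow> 'm \<Rightarrow> 'm \<Rightarrow> 'm" where
  "sub_arr C f g = add_arr C f (neg_arr C g)"

context category
begin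

lemma arr_Hom: "f \<in> arr C \<Longrightarrow> f \<in> Hom C (src C f) (tgt C f)"
  by (simp add: Hom_iff)

lemma Hom_obj: "f \<in> Hom C A B \<Longrightarrow> A \<in> obj C \<and> B \<in> obj C"
  using src_obj tgt_obj by (auto simp: Hom_iff)

lemma idl: "f \<in> Hom C A B \<Longrightarrow> idn C B \<cdot> f = f"
  using idn_left by (auto simp: Hom_iff)

lemma idr: "f \<in> Hom C A B \<Longrightarrow> f \<cdot> idn C A = f"
  using idn_right by (auto simp: Hom_iff)

lemma is_isoI:
  "\<lbrakk>f \<in> Hom C A B; g \<in> Hom C B A; g \<cdot> f = idn C A; f \<cdot> g = idn C B\<rbrakk> \<Longrightarrow> is_iso C f"
  by (auto simp: is_iso_def Hom_iff)

lemma is_isoE: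
  assumes "is_iso C f" "f \<in> Hom C A B"
  obtains g where "g \<in> Hom C B A" "g \<cdot> f = idn C A" "f \<cdot> g = idn C B"
  using assms by (auto simp: is_iso_def Hom_iff)

lemma is_iso_idn: "A \<in> obj C \<Longrightarrow> is_iso C (idn C A)"
  by (meson idl idn_hom is_isoI)

lemma subcategory_iso:
  assumes X: "is_subcategory C X" and f: "is_iso C f" "f \<in> Hom C A B"
  shows "A \<in> X \<longleftrightarrow> B \<in> X"
proof -
  obtain g where g: "g \<in> Hom C B A" "g \<cdot> f = idn C A" "f \<cdot> g = idn C B"
    using is_isoE[OF f] by blast
  have "is_iso C g" using is_isoI[OF g(1) f(2) g(3,2)] .
  then show ?thesis using X f g(1) by (auto simp: is_subcategory_def Hom_iff)
qed

end

lemma full_subcat_simps: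
  "obj (full_subcat C H) = H"
  "arr (full_subcat C H) = {f \<in> arr C. src C f \<in> H \<and> tgt C f \<in> H}"
  "src (full_subcat C H) = src C" "tgt (full_subcat C H) = tgt C"
  "idn (full_subcat C H) = idn C" "compose (full_subcat C H) = compose C"
  "add_arr (full_subcat C H) = add_arr C" "zero_arr (full_subcat C H) = zero_arr C"
  by (simp_all add: full_subcat_def)

lemma iso_full_subcat:
  "is_iso (full_subcat C H) f \<longleftrightarrow> is_iso C f \<and> src C f \<in> H \<and> tgt C f \<in> H"
  by (auto simp: is_iso_def full_subcat_def Hom_def)

lemma Hom_full_subcat:
  "Hom (full_subcat C H) A B = (if A \<in> H \<and> B \<in> H then Hom C A B else {})"
  by (auto simp: full_subcat_def Hom_def)

text \<open>An isomorphism of the ambient category that starts in \<open>X \<subseteq> H\<close>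
  ends in \<open>H\<close>, because \<open>H\<close> is itself closed under isomorphisms.
  Subcategories of the heart can thus be handled as subcategories of the whole category.\<close>

lemma is_subcategory_full_subcat_iff:
  assumes "is_subcategory C H"
  shows "is_subcategory (full_subcat C H) X \<longleftrightarrow> is_subcategory C X \<and> X \<subseteq> H"
  using assms unfolding is_subcategory_def iso_full_subcat
  by (auto simp: full_subcat_def)

section \<open>Bilinear calculus, zero objects and biproducts\<close>

context additive_category
begin

lemma neg_arr_eq: "f \<in> Hom C A B \<Longrightarrow> neg_arr C f = inv\<^bsub>hom_group C A B\<^esub> f"
  by (simp add: neg_arr_def Hom_iff)

lemma zero_Hom: "\<lbrakk>A \<in> obj C; B \<in> obj C\<rbrakk> \<Longrightarrow> zero_arr C A B \<in> Hom C A B"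
  using monoid.one_closed[OF group.is_monoid[OF comm_group.axioms(2)[OF hom_group]]]
  by (fastforce simp: hom_group_def)

lemma Hom_group: "f \<in> Hom C A B \<Longrightarrow> comm_group (Defs.hom_group C A B)"
  using hom_group Hom_obj by blast

lemma add_Hom: "\<lbrakk>f \<in> Hom C A B; g \<in> Hom C A B\<rbrakk> \<Longrightarrow> add_arr C f g \<in> Hom C A B"
  using Hom_group[of f A B] comm_group.axioms(2) group.is_monoid monoid.m_closed
  by (fastforce simp: hom_group_def)

lemma neg_Hom: "f \<in> Hom C A B \<Longrightarrow> neg_arr C f \<in> Hom C A B"
  using Hom_group[of f A B] group.inv_closed[OF comm_group.axioms(2), of "Defs.hom_group C A B" f]
  unfolding neg_arr_eq by (simp add: hom_group_def)

lemma sub_Hom: "\<lbrakk>f \<in> Hom C A B; g \<in> Hom C A B\<rbrakk> \<Longrightarrow> sub_arr C f g \<in> Hom C A B"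
  by (simp add: sub_arr_def add_Hom neg_Hom)

lemma add_zero_left: "f \<in> Hom C A B \<Longrightarrow> add_arr C (zero_arr C A B) f = f"
  using monoid.l_one[OF group.is_monoid[OF comm_group.axioms(2)[OF Hom_group]], of f A B f]
  by (simp add: hom_group_def)

lemma add_zero_right: "f \<in> Hom C A B \<Longrightarrow> add_arr C f (zero_arr C A B) = f"
  using monoid.r_one[OF group.is_monoid[OF comm_group.axioms(2)[OF Hom_group]], of f A B f]
  by (simp add: hom_group_def)

lemma add_neg: "f \<in> Hom C A B \<Longrightarrow> add_arr C f (neg_arr C f) = zero_arr C A B"
  using group.r_inv[OF comm_group.axioms(2)[OF Hom_group], of f A B f]
  by (simp add: neg_arr_eq hom_group_def)

text \<open>In a group the only idempotent is the unit. Composition and the shift are assumed to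
  preserve sums only; applied to \<open>0 + 0 = 0\<close>, this makes them preserve zero
  morphisms.\<close>

lemma add_idem_zero:
  "\<lbrakk>f \<in> Hom C A B; add_arr C f f = f\<rbrakk> \<Longrightarrow> f = zero_arr C A B"
  using group.r_cancel_one[OF comm_group.axioms(2)[OF Hom_group], of f A B f f]
  by (simp add: hom_group_def)

lemma neg_unique:
  "\<lbrakk>f \<in> Hom C A B; g \<in> Hom C A B; add_arr C f g = zero_arr C A B\<rbrakk> \<Longrightarrow> neg_arr C f = g"
  using group.inv_equality[OF comm_group.axioms(2)[OF Hom_group], of f A B g f]
    comm_monoid.m_comm[OF comm_group.axioms(1)[OF Hom_group], of f A B f g]
  by (simp add: neg_arr_eq hom_group_def)

lemma neg_neg: "f \<in> Hom C A B \<Longrightarrow> neg_arr C (neg_arr C f) = f"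
  using group.inv_inv[OF comm_group.axioms(2)[OF Hom_group], of f A B f] neg_Hom[of f A B]
  by (simp add: neg_arr_eq) (simp add: hom_group_def)

lemma neg_zero: "\<lbrakk>A \<in> obj C; B \<in> obj C\<rbrakk> \<Longrightarrow> neg_arr C (zero_arr C A B) = zero_arr C A B"
  by (meson add_zero_left neg_unique zero_Hom)

lemma sub_eq_zero_iff:
  assumes "f \<in> Hom C A B" "g \<in> Hom C A B"
  shows "sub_arr C f g = zero_arr C A B \<longleftrightarrow> f = g"
proof
  assume "sub_arr C f g = zero_arr C A B"
  then have "neg_arr C f = neg_arr C g"
    using assms by (simp add: neg_Hom neg_unique sub_arr_def)
  then show "f = g" using assms neg_neg by metis
next
  assume "f = g"
  then show "sub_arr C f g = zero_arr C A B"
    using assms by (simp add: sub_arr_def add_neg)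
qed

lemma compose_zero_right:
  assumes "g \<in> Hom C B D" "A \<in> obj C"
  shows "g \<cdot> zero_arr C A B = zero_arr C A D"
proof -
  have z: "zero_arr C A B \<in> Hom C A B" using assms Hom_obj zero_Hom by blast
  show ?thesis
    using compose_add_right[OF z z assms(1)] compose_hom[OF z assms(1)] add_idem_zero
    by (simp add: add_zero_left[OF z])
qed

lemma compose_zero_left:
  assumes "f \<in> Hom C A B" "D \<in> obj C"
  shows "zero_arr C B D \<cdot> f = zero_arr C A D"
proof -
  have z: "zero_arr C B D \<in> Hom C B D" using assms Hom_obj zero_Hom by blast
  show ?thesis
    using compose_add_left[OF assms(1) z z] compose_hom[OF assms(1) z] add_idem_zero
    by (simp add: add_zero_left[OF z])
qed

lemma compose_neg_right:
  assumes "f \<in> Hom C X Y" "g \<in> Hom C Y Z"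
  shows "g \<cdot> neg_arr C f = neg_arr C (g \<cdot> f)"
proof -
  have "add_arr C (g \<cdot> f) (g \<cdot> neg_arr C f) = zero_arr C X Z"
    using compose_add_right[OF assms(1) neg_Hom[OF assms(1)] assms(2)] Hom_obj[OF assms(1)]
    by (simp add: add_neg[OF assms(1)] compose_zero_right[OF assms(2)])
  from neg_unique[OF compose_hom[OF assms] compose_hom[OF neg_Hom[OF assms(1)] assms(2)] this]
  show ?thesis by simp
qed

lemma compose_neg_left:
  assumes "f \<in> Hom C X Y" "g \<in> Hom C Y Z"
  shows "neg_arr C g \<cdot> f = neg_arr C (g \<cdot> f)"
proof -
  have "add_arr C (g \<cdot> f) (neg_arr C g \<cdot> f) = zero_arr C X Z"
    using compose_add_left[OF assms neg_Hom[OF assms(2)]] Hom_obj[OF assms(2)]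
    by (simp add: add_neg[OF assms(2)] compose_zero_left[OF assms(1)])
  from neg_unique[OF compose_hom[OF assms] compose_hom[OF assms(1) neg_Hom[OF assms(2)]] this]
  show ?thesis by simp
qed

lemma compose_sub_right:
  "\<lbrakk>f \<in> Hom C X Y; f' \<in> Hom C X Y; g \<in> Hom C Y Z\<rbrakk>
    \<Longrightarrow> g \<cdot> sub_arr C f f' = sub_arr C (g \<cdot> f) (g \<cdot> f')"
  by (simp add: sub_arr_def compose_add_right neg_Hom compose_neg_right)

lemma compose_sub_left:
  "\<lbrakk>f \<in> Hom C X Y; g \<in> Hom C Y Z; g' \<in> Hom C Y Z\<rbrakk>
    \<Longrightarrow> sub_arr C g g' \<cdot> f = sub_arr C (g \<cdot> f) (g' \<cdot> f)"
  by (simp add: sub_arr_def compose_add_left neg_Hom compose_neg_left)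

text \<open>A morphism into or out of \<open>Z\<close> absorbs the identity of \<open>Z\<close>, so
  it vanishes once that identity does. In this equational form, being a zero object passes through
  the shift.\<close>

lemma zero_object_iff:
  "is_zero_object C Z \<longleftrightarrow> Z \<in> obj C \<and> idn C Z = zero_arr C Z Z"
proof
  assume "is_zero_object C Z"
  then show "Z \<in> obj C \<and> idn C Z = zero_arr C Z Z"
    unfolding is_zero_object_def using idn_hom zero_Hom by blast
next
  assume Z: "Z \<in> obj C \<and> idn C Z = zero_arr C Z Z"
  have "f = zero_arr C A Z" if "f \<in> Hom C A Z" for A f
    using Z that by (metis compose_zero_left idl)
  moreover have "f = zero_arr C Z A" if "f \<in> Hom C Z A" for A f
    using Z that by (metis compose_zero_right idr)
  ultimately show "is_zero_object C Z"
    unfolding is_zero_object_def using Z zero_Hom by blast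
qed

lemma zero_object_Hom_from:
  "\<lbrakk>is_zero_object C Z; f \<in> Hom C Z A\<rbrakk> \<Longrightarrow> f = zero_arr C Z A"
  using idr[of f Z A] compose_zero_right[of f Z A Z] by (simp add: zero_object_iff)

lemma zero_object_Hom_to:
  "\<lbrakk>is_zero_object C Z; f \<in> Hom C A Z\<rbrakk> \<Longrightarrow> f = zero_arr C A Z"
  using idl[of f A Z] compose_zero_left[of f A Z Z] by (simp add: zero_object_iff)

lemma hom_vanishes_iff:
  assumes "X \<subseteq> obj C" "Y \<subseteq> obj C"
  shows "hom_vanishes C X Y \<longleftrightarrow> (\<forall>A \<in> X. \<forall>B \<in> Y. \<forall>f \<in> Hom C A B. f = zero_arr C A B)"
proof -
  have "Hom C A B = {zero_arr C A B} \<longleftrightarrow> (\<forall>f \<in> Hom C A B. f = zero_arr C A B)"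
    if "A \<in> X" "B \<in> Y" for A B
    using zero_Hom[of A B] assms that by blast
  then show ?thesis by (simp add: hom_vanishes_def)
qed

lemma hom_vanishesD:
  "\<lbrakk>hom_vanishes C X Y; A \<in> X; B \<in> Y; f \<in> Hom C A B\<rbrakk> \<Longrightarrow> f = zero_arr C A B"
  unfolding hom_vanishes_def by blast

lemma biproductD:
  assumes "is_biproduct C A B P i j p q"
  shows "P \<in> obj C" "i \<in> Hom C A P" "j \<in> Hom C B P" "p \<in> Hom C P A" "q \<in> Hom C P B"
    "p \<cdot> i = idn C A" "q \<cdot> j = idn C B" "q \<cdot> i = zero_arr C A B" "p \<cdot> j = zero_arr C B A"
    "add_arr C (i \<cdot> p) (j \<cdot> q) = idn C P"
  using assms by (simp_all add: is_biproduct_def)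

text \<open>Since \<open>i p + j q\<close> is the identity of \<open>P\<close>, every
  \<open>f\<close> out of \<open>P\<close> equals \<open>f i p + f j q\<close>.\<close>

lemma biproduct_from_eqI:
  assumes P: "is_biproduct C A B P i j p q" and fg: "f \<in> Hom C P W" "g \<in> Hom C P W"
    and eq: "f \<cdot> i = g \<cdot> i" "f \<cdot> j = g \<cdot> j"
  shows "f = g"
proof -
  note b = biproductD[OF P]
  have "f = add_arr C (f \<cdot> i \<cdot> p) (f \<cdot> j \<cdot> q)" if f: "f \<in> Hom C P W" for f
    using compose_add_right[OF compose_hom[OF b(4,2)] compose_hom[OF b(5,3)] f] idr[OF f] b(10)
      compose_assoc[OF b(4,2) f] compose_assoc[OF b(5,3) f] by simp
  from this[OF fg(1)] this[OF fg(2)] eq show ?thesis by simp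
qed

lemma biproduct_to_eqI:
  assumes P: "is_biproduct C A B P i j p q" and fg: "f \<in> Hom C W P" "g \<in> Hom C W P"
    and eq: "p \<cdot> f = p \<cdot> g" "q \<cdot> f = q \<cdot> g"
  shows "f = g"
proof -
  note b = biproductD[OF P]
  have "f = add_arr C (i \<cdot> (p \<cdot> f)) (j \<cdot> (q \<cdot> f))" if f: "f \<in> Hom C W P" for f
    using compose_add_left[OF f compose_hom[OF b(4,2)] compose_hom[OF b(5,3)]] idl[OF f] b(10)
      compose_assoc[OF f b(4,2)] compose_assoc[OF f b(5,3)] by simp
  from this[OF fg(1)] this[OF fg(2)] eq show ?thesis by simp
qed

lemma biproduct_copair:
  assumes P: "is_biproduct C A B P i j p q" and f: "f \<in> Hom C A W" and g: "g \<in> Hom C B W"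
  obtains m where "m \<in> Hom C P W" "m \<cdot> i = f" "m \<cdot> j = g"
proof -
  note b = biproductD[OF P]
  note fp = compose_hom[OF b(4) f] and gq = compose_hom[OF b(5) g]
  have A: "A \<in> obj C" "B \<in> obj C" using Hom_obj[OF f] Hom_obj[OF g] by simp_all
  let ?m = "add_arr C (f \<cdot> p) (g \<cdot> q)"
  have "?m \<cdot> i = f"
    using compose_add_left[OF b(2) fp gq] compose_assoc[OF b(2,4) f] compose_assoc[OF b(2,5) g]
      idr[OF f] compose_zero_right[OF g A(1)] add_zero_right[OF f] by (simp add: b(6,8))
  moreover have "?m \<cdot> j = g"
    using compose_add_left[OF b(3) fp gq] compose_assoc[OF b(3,4) f] compose_assoc[OF b(3,5) g]
      idr[OF g] compose_zero_right[OF f A(2)] add_zero_left[OF g] by (simp add: b(7,9))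
  ultimately show ?thesis using that add_Hom[OF fp gq] by blast
qed

lemma biproduct_pair:
  assumes P: "is_biproduct C A B P i j p q" and f: "f \<in> Hom C W A" and g: "g \<in> Hom C W B"
  obtains m where "m \<in> Hom C W P" "p \<cdot> m = f" "q \<cdot> m = g"
proof -
  note b = biproductD[OF P]
  note fp = compose_hom[OF f b(2)] and gq = compose_hom[OF g b(3)]
  have A: "A \<in> obj C" "B \<in> obj C" using Hom_obj[OF f] Hom_obj[OF g] by simp_all
  let ?m = "add_arr C (i \<cdot> f) (j \<cdot> g)"
  have "p \<cdot> ?m = f"
    using compose_add_right[OF fp gq b(4)] compose_assoc[OF f b(2,4)] compose_assoc[OF g b(3,4)]
      idl[OF f] compose_zero_left[OF g A(1)] add_zero_right[OF f] by (simp add: b(6,9))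
  moreover have "q \<cdot> ?m = g"
    using compose_add_right[OF fp gq b(5)] compose_assoc[OF f b(2,5)] compose_assoc[OF g b(3,5)]
      idl[OF g] compose_zero_left[OF f A(2)] add_zero_left[OF g] by (simp add: b(7,8))
  ultimately show ?thesis using that add_Hom[OF fp gq] by blast
qed

end

section \<open>Triangulated categories\<close>

text \<open>The record stores a triangle as a bare triple of morphisms. Naming the three objects
  lets diagram chases carry typed morphisms instead of equations between sources and
  targets.\<close>

definition triangle ::
  "('o, 'm, 'x) triangulated_cat_scheme \<Rightarrow> 'o \<Rightarrow> 'o \<Rightarrow> 'o \<Rightarrow> 'm \<Rightarrow> 'm \<Rightarrow> 'm \<Rightarrow> bool" where
  "triangle D X Y Z f g h \<longleftrightarrow> (f, g, h) \<in> triangles D \<and>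
     f \<in> Hom D X Y \<and> g \<in> Hom D Y Z \<and> h \<in> Hom D Z (shift_obj D X)"

context triangulated_category
begin

lemma triangle_of_triangles:
  assumes "(f, g, h) \<in> triangles D"
  shows "triangle D (src D f) (tgt D f) (tgt D g) f g h"
  using triangle_candidate[OF assms] assms
  by (auto simp: triangle_def is_candidate_triangle_def Hom_iff)

lemma star_iff: "M \<in> star D X Y \<longleftrightarrow> (\<exists>A \<in> X. \<exists>B \<in> Y. \<exists>f g h. triangle D A M B f g h)"
proof
  assume "M \<in> star D X Y"
  then show "\<exists>A \<in> X. \<exists>B \<in> Y. \<exists>f g h. triangle D A M B f g h"
    unfolding star_def using triangle_of_triangles by blast
next
  assume "\<exists>A \<in> X. \<exists>B \<in> Y. \<exists>f g h. triangle D A M B f g h"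
  then show "M \<in> star D X Y"
    unfolding star_def triangle_def using Hom_obj by (fastforce simp: Hom_iff)
qed

lemma starI: "\<lbrakk>triangle D A M B f g h; A \<in> X; B \<in> Y\<rbrakk> \<Longrightarrow> M \<in> star D X Y"
  unfolding star_iff by blast

lemma star_mono: "\<lbrakk>X \<subseteq> X'; Y \<subseteq> Y'\<rbrakk> \<Longrightarrow> star D X Y \<subseteq> star D X' Y'"
  unfolding star_def by blast

section \<open>The shift as an additive auto-equivalence\<close>

lemma shift_obj_obj: "A \<in> obj D \<Longrightarrow> shift_obj D A \<in> obj D"
  using shift_functor by (auto simp: is_additive_functor_def is_functor_def)

lemma unshift_obj_obj: "A \<in> obj D \<Longrightarrow> unshift_obj D A \<in> obj D"
  using unshift_functor by (auto simp: is_additive_functor_def is_functor_def)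

lemma shift_Hom: "f \<in> Hom D A B \<Longrightarrow> shift_arr D f \<in> Hom D (shift_obj D A) (shift_obj D B)"
  using shift_functor by (auto simp: is_additive_functor_def is_functor_def Hom_iff)

lemma unshift_Hom:
  "f \<in> Hom D A B \<Longrightarrow> unshift_arr D f \<in> Hom D (unshift_obj D A) (unshift_obj D B)"
  using unshift_functor by (auto simp: is_additive_functor_def is_functor_def Hom_iff)

lemma shift_idn: "A \<in> obj D \<Longrightarrow> shift_arr D (idn D A) = idn D (shift_obj D A)"
  using shift_functor by (auto simp: is_additive_functor_def is_functor_def)

lemma shift_compose:
  "\<lbrakk>f \<in> Hom D A B; g \<in> Hom D B C\<rbrakk> \<Longrightarrow> shift_arr D (g \<cdot> f) = shift_arr D g \<cdot> shift_arr D f"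
  using shift_functor by (auto simp: is_additive_functor_def is_functor_def Hom_iff)

lemma shift_add:
  "\<lbrakk>f \<in> Hom D A B; g \<in> Hom D A B\<rbrakk>
    \<Longrightarrow> shift_arr D (add_arr D f g) = add_arr D (shift_arr D f) (shift_arr D g)"
  using shift_functor Hom_obj[of f A B] unfolding is_additive_functor_def by blast

lemma shift_zero:
  assumes "A \<in> obj D" "B \<in> obj D"
  shows "shift_arr D (zero_arr D A B) = zero_arr D (shift_obj D A) (shift_obj D B)"
  using shift_add[OF zero_Hom[OF assms] zero_Hom[OF assms]]
    add_idem_zero[OF shift_Hom[OF zero_Hom[OF assms]]]
  by (simp add: add_zero_left[OF zero_Hom[OF assms]])

lemma shift_zero_object: "is_zero_object D Z \<Longrightarrow> is_zero_object D (shift_obj D Z)"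
  by (metis shift_idn shift_obj_obj shift_zero zero_object_iff)

text \<open>Naturality reads \<open>\<tau> B \<cdot> Fa f = f \<cdot> \<tau> A\<close>, and
  \<open>\<tau> A\<close> can be cancelled on the right, so \<open>f\<close> is determined by
  \<open>Fa f\<close>. Applied to the two composites of shift and unshift, it makes each of them
  faithful.\<close>

lemma iso_to_id_faithful:
  assumes "naturally_isomorphic D D Fo Fa id id" "f \<in> Hom D A B" "f' \<in> Hom D A B"
    and "Fa f = Fa f'"
  shows "f = f'"
proof -
  obtain \<tau> where \<tau>: "\<And>A. A \<in> obj D \<Longrightarrow> \<tau> A \<in> Hom D (Fo A) A \<and> is_iso D (\<tau> A)"
    "\<And>f. f \<in> arr D \<Longrightarrow> \<tau> (tgt D f) \<cdot> Fa f = f \<cdot> \<tau> (src D f)"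
    using assms(1) unfolding naturally_isomorphic_def by auto
  have A: "A \<in> obj D" using assms Hom_obj by auto
  then obtain s where s: "s \<in> Hom D A (Fo A)" "\<tau> A \<cdot> s = idn D A"
    using \<tau>(1) is_isoE by metis
  have "f \<cdot> \<tau> A = f' \<cdot> \<tau> A"
    using \<tau>(2)[of f] \<tau>(2)[of f'] assms by (simp add: Hom_iff)
  then have "f \<cdot> (\<tau> A \<cdot> s) = f' \<cdot> (\<tau> A \<cdot> s)"
    using compose_assoc[OF s(1) _ assms(2)] compose_assoc[OF s(1) _ assms(3)] \<tau>(1)[OF A] by metis
  then show ?thesis using s idr assms by metis
qed

lemma shift_faithful:
  "\<lbrakk>f \<in> Hom D A B; g \<in> Hom D A B; shift_arr D f = shift_arr D g\<rbrakk> \<Longrightarrow> f = g"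
  using iso_to_id_faithful[OF unshift_shift] by simp

lemma unshift_faithful:
  "\<lbrakk>f \<in> Hom D A B; g \<in> Hom D A B; unshift_arr D f = unshift_arr D g\<rbrakk> \<Longrightarrow> f = g"
  using iso_to_id_faithful[OF shift_unshift] by simp

lemma shift_eq_zeroD:
  "\<lbrakk>f \<in> Hom D A B; shift_arr D f = zero_arr D (shift_obj D A) (shift_obj D B)\<rbrakk>
    \<Longrightarrow> f = zero_arr D A B"
  using shift_faithful[of f A B "zero_arr D A B"] Hom_obj[of f A B]
  by (simp add: shift_zero zero_Hom)

lemma shift_full:
  assumes g: "g \<in> Hom D (shift_obj D A) (shift_obj D B)" and "A \<in> obj D" "B \<in> obj D"
  obtains f where "f \<in> Hom D A B" "shift_arr D f = g"
proof -
  obtain \<tau> where \<tau>: "\<And>A. A \<in> obj D \<Longrightarrow> \<tau> A \<in> Hom D (unshift_obj D (shift_obj D A)) A \<and> is_iso D (\<tau> A)"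
    "\<And>f. f \<in> arr D \<Longrightarrow> \<tau> (tgt D f) \<cdot> unshift_arr D (shift_arr D f) = f \<cdot> \<tau> (src D f)"
    using unshift_shift unfolding naturally_isomorphic_def by auto
  obtain s where s: "s \<in> Hom D A (unshift_obj D (shift_obj D A))" "s \<cdot> \<tau> A = idn D (unshift_obj D (shift_obj D A))"
    using \<tau>(1) is_isoE assms(2) by metis
  obtain t where t: "t \<in> Hom D B (unshift_obj D (shift_obj D B))" "t \<cdot> \<tau> B = idn D (unshift_obj D (shift_obj D B))"
    using \<tau>(1) is_isoE assms(3) by metis
  let ?g = "unshift_arr D g"
  \<comment> \<open>The preimage is \<open>unshift_arr D g\<close> transported along \<tau>.
    Naturality shows that \<open>shift_arr D ?f\<close> and \<open>g\<close> agree after unshifting,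
    and the unshift is faithful.\<close>
  let ?f = "\<tau> B \<cdot> ?g \<cdot> s"
  note [simp] = \<tau>(1)[OF assms(2), THEN conjunct1] \<tau>(1)[OF assms(3), THEN conjunct1]
  have g': "?g \<in> Hom D (unshift_obj D (shift_obj D A)) (unshift_obj D (shift_obj D B))"
    using g unshift_Hom by blast
  have bg: "\<tau> B \<cdot> ?g \<in> Hom D (unshift_obj D (shift_obj D A)) B"
    using g' \<tau>(1) assms compose_hom by blast
  have f: "?f \<in> Hom D A B" using bg s compose_hom by blast
  have F: "unshift_arr D (shift_arr D ?f) \<in> Hom D (unshift_obj D (shift_obj D A)) (unshift_obj D (shift_obj D B))"
    using f shift_Hom unshift_Hom by blast
  have "\<tau> B \<cdot> unshift_arr D (shift_arr D ?f) = ?f \<cdot> \<tau> A"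
    using \<tau>(2)[of ?f] f by (simp add: Hom_iff)
  also have "\<dots> = \<tau> B \<cdot> ?g \<cdot> (s \<cdot> \<tau> A)"
    using compose_assoc[OF _ s(1) bg] \<tau>(1) assms by blast
  also have "\<dots> = \<tau> B \<cdot> ?g" using s idr[OF bg] by simp
  finally have "t \<cdot> \<tau> B \<cdot> unshift_arr D (shift_arr D ?f) = t \<cdot> \<tau> B \<cdot> ?g"
    using compose_assoc[OF F _ t(1)] compose_assoc[OF g' _ t(1)] \<tau>(1) assms by metis
  then have "unshift_arr D (shift_arr D ?f) = ?g"
    using t idl F g' by metis
  then have "shift_arr D ?f = g"
    using unshift_faithful[OF shift_Hom[OF f] g] by blast
  then show ?thesis using that f by blast
qed

lemma shift_unshift_iso:
  assumes "A \<in> obj D"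
  obtains a b where "a \<in> Hom D (shift_obj D (unshift_obj D A)) A"
    "b \<in> Hom D A (shift_obj D (unshift_obj D A))"
    "b \<cdot> a = idn D (shift_obj D (unshift_obj D A))" "a \<cdot> b = idn D A"
proof -
  obtain \<tau> where \<tau>: "\<And>A. A \<in> obj D \<Longrightarrow> \<tau> A \<in> Hom D (shift_obj D (unshift_obj D A)) A \<and> is_iso D (\<tau> A)"
    using shift_unshift unfolding naturally_isomorphic_def by auto
  then show ?thesis using that assms is_isoE by metis
qed

text \<open>The isomorphism \<Sigma>\<Sigma>^-1 B -> B together with fullness and faithfulness of
  the shift identifies D(A, \<Sigma>^-1 B) with D(\<Sigma>A, B). This is how the negative extension
  in the definition of s-torsion pairs is eliminated.\<close>

lemma hom_vanishes_unshift:
  assumes "X \<subseteq> obj D" "Y \<subseteq> obj D"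
  shows "hom_vanishes D X (unshift_obj D ` Y) \<longleftrightarrow> hom_vanishes D (shift_obj D ` X) Y"
proof -
  have sX: "shift_obj D ` X \<subseteq> obj D" and uY: "unshift_obj D ` Y \<subseteq> obj D"
    using assms shift_obj_obj unshift_obj_obj by auto
  have "(\<forall>f \<in> Hom D A (unshift_obj D B). f = zero_arr D A (unshift_obj D B)) \<longleftrightarrow>
      (\<forall>f \<in> Hom D (shift_obj D A) B. f = zero_arr D (shift_obj D A) B)" (is "?l \<longleftrightarrow> ?r")
    if "A \<in> X" "B \<in> Y" for A B
  proof -
    let ?B = "shift_obj D (unshift_obj D B)"
    have A: "A \<in> obj D" and B: "B \<in> obj D" and uB: "unshift_obj D B \<in> obj D"
      using that assms unshift_obj_obj by auto
    obtain a b where a: "a \<in> Hom D ?B B" and b: "b \<in> Hom D B ?B"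
      and ba: "b \<cdot> a = idn D ?B" and ab: "a \<cdot> b = idn D B"
      using shift_unshift_iso B by blast
    show ?thesis
    proof
      assume l: ?l
      show ?r
      proof
        fix f assume f: "f \<in> Hom D (shift_obj D A) B"
        obtain g where "g \<in> Hom D A (unshift_obj D B)" "shift_arr D g = b \<cdot> f"
          using shift_full compose_hom[OF f b] A uB by blast
        with l have "b \<cdot> f = zero_arr D (shift_obj D A) ?B" using shift_zero A uB by auto
        then have "a \<cdot> (b \<cdot> f) = zero_arr D (shift_obj D A) B"
          using compose_zero_right a A shift_obj_obj by metis
        then show "f = zero_arr D (shift_obj D A) B"
          using compose_assoc[OF f b a] ab idl[OF f] by simp
      qed
    next
      assume r: ?r
      show ?l
      proof
        fix f assume f: "f \<in> Hom D A (unshift_obj D B)"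
        note sf = shift_Hom[OF f]
        have "a \<cdot> shift_arr D f = zero_arr D (shift_obj D A) B"
          using r compose_hom[OF sf a] by blast
        then have "b \<cdot> (a \<cdot> shift_arr D f) = zero_arr D (shift_obj D A) ?B"
          using compose_zero_right b A shift_obj_obj by metis
        then have "shift_arr D f = zero_arr D (shift_obj D A) ?B"
          using compose_assoc[OF sf a b] ba idl[OF sf] by simp
        then show "f = zero_arr D A (unshift_obj D B)" using shift_eq_zeroD f by blast
      qed
    qed
  qed
  then show ?thesis
    unfolding hom_vanishes_iff[OF assms(1) uY] hom_vanishes_iff[OF sX assms(2)] by simp
qed


section \<open>Rotation, exactness of Hom sequences, and triangles with a zero map\<close>

lemma triangleD:
  assumes "triangle D X Y Z f g h"
  shows "f \<in> Hom D X Y" "g \<in> Hom D Y Z" "h \<in> Hom D Z (shift_obj D X)"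
    "X \<in> obj D" "Y \<in> obj D" "Z \<in> obj D"
  using assms Hom_obj[of f X Y] Hom_obj[of g Y Z] by (simp_all add: triangle_def)

lemma triangle_rotate_iff:
  assumes "f \<in> Hom D X Y" "g \<in> Hom D Y Z" "h \<in> Hom D Z (shift_obj D X)"
  shows "triangle D X Y Z f g h \<longleftrightarrow>
    triangle D Y Z (shift_obj D X) g h (neg_arr D (shift_arr D f))"
proof -
  have "is_candidate_triangle D (f, g, h)"
    using assms by (simp add: is_candidate_triangle_def Hom_iff)
  from triangle_rotate[OF this] show ?thesis
    using assms neg_Hom[OF shift_Hom[OF assms(1)]] by (simp add: triangle_def)
qed

lemma triangle_rotated:
  "triangle D X Y Z f g h \<Longrightarrow> triangle D Y Z (shift_obj D X) g h (neg_arr D (shift_arr D f))"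
  using triangle_rotate_iff[of f X Y g Z h] triangleD(1-3)[of X Y Z f g h] by simp

text \<open>Three rotations shift every term and negate every map. Because rotation is an
  equivalence, triangles can also be desuspended this way.\<close>

lemma triangle_rotate3_iff:
  assumes "f \<in> Hom D X Y" "g \<in> Hom D Y Z" "h \<in> Hom D Z (shift_obj D X)"
  shows "triangle D X Y Z f g h \<longleftrightarrow>
    triangle D (shift_obj D X) (shift_obj D Y) (shift_obj D Z)
      (neg_arr D (shift_arr D f)) (neg_arr D (shift_arr D g)) (neg_arr D (shift_arr D h))"
  unfolding triangle_rotate_iff[OF assms]
    triangle_rotate_iff[OF assms(2,3) neg_Hom[OF shift_Hom[OF assms(1)]]]
    triangle_rotate_iff[OF assms(3) neg_Hom[OF shift_Hom[OF assms(1)]] neg_Hom[OF shift_Hom[OF assms(2)]]]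
  by (rule refl)

lemma triangle_unshift:
  assumes "triangle D (shift_obj D X) (shift_obj D Y) (shift_obj D Z) u v w"
    and X: "X \<in> obj D" and Y: "Y \<in> obj D" and Z: "Z \<in> obj D"
  obtains f g h where "triangle D X Y Z f g h"
proof -
  note uvw = triangleD(1-3)[OF assms(1)]
  \<comment> \<open>Preimages of the negatives are taken so that the three signs of the triple
    rotation cancel.\<close>
  obtain f where f: "f \<in> Hom D X Y" "shift_arr D f = neg_arr D u"
    using shift_full neg_Hom[OF uvw(1)] X Y by blast
  obtain g where g: "g \<in> Hom D Y Z" "shift_arr D g = neg_arr D v"
    using shift_full neg_Hom[OF uvw(2)] Y Z by blast
  obtain h where h: "h \<in> Hom D Z (shift_obj D X)" "shift_arr D h = neg_arr D w"
    using shift_full neg_Hom[OF uvw(3)] Z X shift_obj_obj by blast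
  have "triangle D X Y Z f g h"
    using assms(1) unfolding triangle_rotate3_iff[OF f(1) g(1) h(1)] f(2) g(2) h(2)
    by (simp add: neg_neg[OF uvw(1)] neg_neg[OF uvw(2)] neg_neg[OF uvw(3)])
  then show ?thesis by (rule that)
qed

lemma triangle_morphism:
  assumes "triangle D X Y Z f g h" "triangle D X' Y' Z' f' g' h'"
    and "a \<in> Hom D X X'" "b \<in> Hom D Y Y'" "b \<cdot> f = f' \<cdot> a"
  obtains c where "c \<in> Hom D Z Z'" "c \<cdot> g = g' \<cdot> b" "shift_arr D a \<cdot> h = h' \<cdot> c"
proof -
  have "\<exists>c. is_triangle_morphism D (f, g, h) (f', g', h') a b c"
    by (rule triangle_complete) (use assms in \<open>auto simp: triangle_def Hom_iff\<close>)
  then show ?thesis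
    using that assms(1,2) by (auto simp: is_triangle_morphism_def triangle_def Hom_iff)
qed

lemma triangle_idn_zero:
  assumes "X \<in> obj D" "is_zero_object D Z"
  shows "triangle D X X Z (idn D X) (zero_arr D X Z) (zero_arr D Z (shift_obj D X))"
  using triangle_idn[OF assms] assms
  by (simp add: triangle_def idn_hom zero_Hom shift_obj_obj zero_object_iff)

text \<open>Its rotation is the identity triangle on \<open>X\<close> with third term \<Sigma>Z,
  which is again a zero object; the sign falls on a zero map.\<close>

lemma triangle_zero_idn:
  assumes X: "X \<in> obj D" and Z: "is_zero_object D Z"
  shows "triangle D Z X X (zero_arr D Z X) (idn D X) (zero_arr D X (shift_obj D Z))"
proof -
  have Zo: "Z \<in> obj D" and sZ: "is_zero_object D (shift_obj D Z)"
    using Z shift_zero_object by (auto simp: zero_object_iff)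
  show ?thesis
    unfolding triangle_rotate_iff[OF zero_Hom[OF Zo X] idn_hom[OF X] zero_Hom[OF X shift_obj_obj[OF Zo]]]
    using triangle_idn_zero[OF X sZ] X Zo by (simp add: shift_zero neg_zero shift_obj_obj)
qed

text \<open>The pair of \<open>idn D X\<close> and \<open>f\<close> maps the triangle X -> X -> 0 to
  the given one, so \<open>g \<cdot> f\<close> factors through a zero object.\<close>

lemma triangle_compose_zero:
  assumes "triangle D X Y Z f g h"
  shows "g \<cdot> f = zero_arr D X Z"
proof -
  note fgh = triangleD[OF assms]
  obtain N where N: "is_zero_object D N" using zero_object by blast
  obtain c where c: "c \<in> Hom D N Z" "c \<cdot> zero_arr D X N = g \<cdot> f"
    using triangle_morphism[OF triangle_idn_zero[OF fgh(4) N] assms idn_hom[OF fgh(4)] fgh(1)]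
    by blast
  then show ?thesis using compose_zero_right[OF c(1) fgh(4)] by simp
qed

text \<open>As \<open>k\<close> kills \<open>f\<close>, it is the middle component of a morphism
  into the triangle 0 -> W -> W; the third component is the required factor.\<close>

lemma triangle_factor:
  assumes T: "triangle D X Y Z f g h" and k: "k \<in> Hom D Y W" "k \<cdot> f = zero_arr D X W"
  obtains l where "l \<in> Hom D Z W" "l \<cdot> g = k"
proof -
  obtain N where N: "is_zero_object D N" using zero_object by blast
  have W: "W \<in> obj D" and No: "N \<in> obj D" and X: "X \<in> obj D"
    using Hom_obj[OF k(1)] N triangleD[OF T] by (auto simp: zero_object_iff)
  have "k \<cdot> f = zero_arr D N W \<cdot> zero_arr D X N"
    using k compose_zero_right[OF zero_Hom[OF No W] X] by simp
  from triangle_morphism[OF T triangle_zero_idn[OF W N] zero_Hom[OF X No] k(1) this]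
  obtain l where "l \<in> Hom D Z W" "l \<cdot> g = idn D W \<cdot> k" by blast
  then show ?thesis using that idl[OF k(1)] by simp
qed

text \<open>The completion axiom supplies a third component only, so W -> W -> 0 and the given
  triangle are both rotated. This produces a lift of \<Sigma>\<open>k\<close> along
  \<Sigma>\<open>f\<close>, which fullness and faithfulness of the shift bring back to a lift of
  \<open>k\<close>.\<close>

lemma triangle_lift:
  assumes T: "triangle D X Y Z f g h" and k: "k \<in> Hom D W Y" "g \<cdot> k = zero_arr D W Z"
  obtains l where "l \<in> Hom D W X" "f \<cdot> l = k"
proof -
  note fgh = triangleD[OF T]
  obtain N where N: "is_zero_object D N" using zero_object by blast
  have W: "W \<in> obj D" and No: "N \<in> obj D" using Hom_obj[OF k(1)] N by (auto simp: zero_object_iff)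
  let ?i = "neg_arr D (shift_arr D (idn D W))"
  have eq: "zero_arr D N Z \<cdot> zero_arr D W N = g \<cdot> k"
    using k compose_zero_left[OF zero_Hom[OF W No] fgh(6)] by simp
  from triangle_morphism[OF triangle_rotated[OF triangle_idn_zero[OF W N]] triangle_rotated[OF T]
      k(1) zero_Hom[OF No fgh(6)] eq]
  obtain c where c: "c \<in> Hom D (shift_obj D W) (shift_obj D X)"
      "shift_arr D k \<cdot> ?i = neg_arr D (shift_arr D f) \<cdot> c" by blast
  note sk = shift_Hom[OF k(1)] and sf = shift_Hom[OF fgh(1)] and si = shift_Hom[OF idn_hom[OF W]]
  have "neg_arr D (shift_arr D k) = neg_arr D (shift_arr D f \<cdot> c)"
    using c(2) compose_neg_right[OF si sk] compose_neg_left[OF c(1) sf] idr[OF sk]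
    by (simp add: shift_idn[OF W])
  then have skc: "shift_arr D k = shift_arr D f \<cdot> c"
    using neg_neg[OF sk] neg_neg[OF compose_hom[OF c(1) sf]] by metis
  obtain l where l: "l \<in> Hom D W X" "shift_arr D l = c"
    using shift_full[OF c(1) W fgh(4)] by blast
  have "shift_arr D (f \<cdot> l) = shift_arr D k"
    using skc l shift_compose[OF l(1) fgh(1)] by simp
  then show ?thesis
    using that l shift_faithful[OF compose_hom[OF l(1) fgh(1)] k(1)] by blast
qed

lemma triangle_lift_connecting:
  assumes T: "triangle D X Y Z f g h"
    and k: "k \<in> Hom D W (shift_obj D X)" "shift_arr D f \<cdot> k = zero_arr D W (shift_obj D Y)"
  obtains l where "l \<in> Hom D W Z" "h \<cdot> l = k"
proof -
  note sf = shift_Hom[OF triangleD(1)[OF T]]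
  have "neg_arr D (shift_arr D f) \<cdot> k = zero_arr D W (shift_obj D Y)"
    using compose_neg_left[OF k(1) sf] k Hom_obj[OF k(1)] Hom_obj[OF sf] by (simp add: neg_zero)
  from triangle_lift[OF triangle_rotated[OF triangle_rotated[OF T]] k(1) this]
  show ?thesis using that by blast
qed

lemma triangle_lift_shift:
  assumes T: "triangle D X Y Z f g h"
    and k: "k \<in> Hom D W (shift_obj D Y)" "shift_arr D g \<cdot> k = zero_arr D W (shift_obj D Z)"
  obtains l where "l \<in> Hom D W (shift_obj D X)" "shift_arr D f \<cdot> l = k"
proof -
  note sf = shift_Hom[OF triangleD(1)[OF T]]
  obtain l where l: "l \<in> Hom D W (shift_obj D X)" "neg_arr D (shift_arr D f) \<cdot> l = k"
    using triangle_lift_connecting[OF triangle_rotated[OF T] k] by blast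
  \<comment> \<open>The sign introduced by rotation is moved onto the lift.\<close>
  have "shift_arr D f \<cdot> neg_arr D l = k"
    using l compose_neg_right[OF l(1) sf] compose_neg_left[OF l(1) sf] by simp
  then show ?thesis using that neg_Hom[OF l(1)] by blast
qed

lemma triangle_factor_shift:
  assumes T: "triangle D X Y Z f g h"
    and k: "k \<in> Hom D (shift_obj D X) W" "k \<cdot> h = zero_arr D Z W"
  obtains l where "l \<in> Hom D (shift_obj D Y) W" "l \<cdot> shift_arr D f = k"
proof -
  note sf = shift_Hom[OF triangleD(1)[OF T]]
  obtain l where l: "l \<in> Hom D (shift_obj D Y) W" "l \<cdot> neg_arr D (shift_arr D f) = k"
    using triangle_factor[OF triangle_rotated[OF triangle_rotated[OF T]] k] by blast
  have "neg_arr D l \<cdot> shift_arr D f = k"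
    using l compose_neg_right[OF sf l(1)] compose_neg_left[OF sf l(1)] by simp
  then show ?thesis using that neg_Hom[OF l(1)] by blast
qed

text \<open>If \<open>f\<close> kills \<open>k - k'\<close>, then \<Sigma>\<open>(k - k')\<close>
  lies in the image of D(\<Sigma>W, Z) under \<open>h\<close>, which is zero. The hypothesis is
  D(\<Sigma>W, Z) = 0 rather than D(W, \<Sigma>^-1 Z) = 0 so that the shift need not be
  inverted.\<close>

lemma triangle_lift_unique:
  assumes T: "triangle D X Y Z f g h" and W: "\<forall>l \<in> Hom D (shift_obj D W) Z. l = zero_arr D (shift_obj D W) Z"
    and k: "k \<in> Hom D W X" "k' \<in> Hom D W X" "f \<cdot> k = f \<cdot> k'"
  shows "k = k'"
proof -
  note fgh = triangleD[OF T]
  let ?s = "sub_arr D k k'"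
  note s = sub_Hom[OF k(1,2)]
  have Wo: "W \<in> obj D" using Hom_obj[OF k(1)] by simp
  have "f \<cdot> ?s = zero_arr D W Y"
    using compose_sub_right[OF k(1,2) fgh(1)] k(3)
      sub_eq_zero_iff[OF compose_hom[OF k(1) fgh(1)] compose_hom[OF k(2) fgh(1)]] by simp
  then have "shift_arr D f \<cdot> shift_arr D ?s = zero_arr D (shift_obj D W) (shift_obj D Y)"
    using shift_compose[OF s fgh(1)] Wo fgh(5) by (simp add: shift_zero)
  from triangle_lift_connecting[OF T shift_Hom[OF s] this]
  obtain l where l: "l \<in> Hom D (shift_obj D W) Z" "h \<cdot> l = shift_arr D ?s" by blast
  have "l = zero_arr D (shift_obj D W) Z" using W l(1) by blast
  then have "shift_arr D ?s = zero_arr D (shift_obj D W) (shift_obj D X)"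
    using l(2) compose_zero_right[OF fgh(3) shift_obj_obj[OF Wo]] by simp
  from shift_eq_zeroD[OF s this] show ?thesis using sub_eq_zero_iff[OF k(1,2)] by simp
qed

text \<open>If \<open>k - k'\<close> kills \<open>g\<close>, it factors through \<open>h\<close>,
  hence through a map \<Sigma>X -> W.\<close>

lemma triangle_factor_unique:
  assumes T: "triangle D X Y Z f g h" and W: "\<forall>l \<in> Hom D (shift_obj D X) W. l = zero_arr D (shift_obj D X) W"
    and k: "k \<in> Hom D Z W" "k' \<in> Hom D Z W" "k \<cdot> g = k' \<cdot> g"
  shows "k = k'"
proof -
  note fgh = triangleD[OF T]
  let ?s = "sub_arr D k k'"
  note s = sub_Hom[OF k(1,2)]
  have "?s \<cdot> g = zero_arr D Y W"
    using compose_sub_left[OF fgh(2) k(1,2)] k(3)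
      sub_eq_zero_iff[OF compose_hom[OF fgh(2) k(1)] compose_hom[OF fgh(2) k(2)]] by simp
  from triangle_factor[OF triangle_rotated[OF T] s this]
  obtain l where l: "l \<in> Hom D (shift_obj D X) W" "l \<cdot> h = ?s" by blast
  have "l = zero_arr D (shift_obj D X) W" using W l(1) by blast
  then have "?s = zero_arr D Z W"
    using l(2) compose_zero_left[OF fgh(3)] Hom_obj[OF k(1)] by simp
  then show ?thesis using sub_eq_zero_iff[OF k(1,2)] by simp
qed

text \<open>Since \<open>f = 0\<close>, the identity of \<open>Y\<close> factors as
  \<open>l \<cdot> g\<close>. Then \<open>g \<cdot> l\<close> and the identity of \<open>Z\<close>
  agree after composition with \<open>g\<close>, and D(\<Sigma>X, Z) = 0 allows \<open>g\<close> to
  be cancelled.\<close>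

lemma triangle_first_zero_iso:
  assumes T: "triangle D X Y Z f g h" and f: "f = zero_arr D X Y"
    and van: "\<forall>l \<in> Hom D (shift_obj D X) Z. l = zero_arr D (shift_obj D X) Z"
  shows "is_iso D g"
proof -
  note fgh = triangleD[OF T]
  note iY = idn_hom[OF fgh(5)] and iZ = idn_hom[OF fgh(6)]
  have "idn D Y \<cdot> f = zero_arr D X Y" using idl[OF fgh(1)] f by simp
  from triangle_factor[OF T iY this]
  obtain l where l: "l \<in> Hom D Z Y" "l \<cdot> g = idn D Y" by blast
  have "g \<cdot> l \<cdot> g = idn D Z \<cdot> g"
    using compose_assoc[OF fgh(2) l(1) fgh(2)] l(2) idr[OF fgh(2)] idl[OF fgh(2)] by simp
  then have "g \<cdot> l = idn D Z"
    using triangle_factor_unique[OF T van compose_hom[OF l(1) fgh(2)] iZ] by blast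
  then show ?thesis using is_isoI[OF fgh(2) l(1) l(2)] by blast
qed

lemma triangle_second_zero_iso:
  assumes T: "triangle D X Y Z f g h" and g: "g = zero_arr D Y Z"
    and van: "\<forall>l \<in> Hom D (shift_obj D X) Z. l = zero_arr D (shift_obj D X) Z"
  shows "is_iso D f"
proof -
  note fgh = triangleD[OF T]
  note iY = idn_hom[OF fgh(5)] and iX = idn_hom[OF fgh(4)]
  have "g \<cdot> idn D Y = zero_arr D Y Z" using idr[OF fgh(2)] g by simp
  from triangle_lift[OF T iY this]
  obtain l where l: "l \<in> Hom D Y X" "f \<cdot> l = idn D Y" by blast
  have "f \<cdot> (l \<cdot> f) = f \<cdot> idn D X"
    using compose_assoc[OF fgh(1) l(1) fgh(1)] l(2) idr[OF fgh(1)] idl[OF fgh(1)] by simp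
  then have "l \<cdot> f = idn D X"
    using triangle_lift_unique[OF T van compose_hom[OF fgh(1) l(1)] iX] by blast
  then show ?thesis using is_isoI[OF fgh(1) l(1)] l(2) by blast
qed

lemma triangle_isomorphic:
  assumes T: "triangle D X Y Z f g h"
    and f': "f' \<in> Hom D X' Y'" and g': "g' \<in> Hom D Y' Z'" and h': "h' \<in> Hom D Z' (shift_obj D X')"
    and a: "a \<in> Hom D X X'" "is_iso D a" and b: "b \<in> Hom D Y Y'" "is_iso D b"
    and c: "c \<in> Hom D Z Z'" "is_iso D c"
    and eq: "b \<cdot> f = f' \<cdot> a" "c \<cdot> g = g' \<cdot> b" "shift_arr D a \<cdot> h = h' \<cdot> c"
  shows "triangle D X' Y' Z' f' g' h'"
proof -
  have "is_candidate_triangle D (f', g', h')"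
    using f' g' h' by (simp add: is_candidate_triangle_def Hom_iff)
  moreover have "is_triangle_morphism D (f, g, h) (f', g', h') a b c"
    using triangleD(1-3)[OF T] f' g' h' a b c eq by (simp add: is_triangle_morphism_def Hom_iff)
  ultimately have "(f', g', h') \<in> triangles D"
    using triangle_iso T a(2) b(2) c(2) unfolding triangle_def by blast
  then show ?thesis using f' g' h' by (simp add: triangle_def)
qed

lemma triangle_on:
  assumes "f \<in> Hom D X Y"
  obtains Z g h where "triangle D X Y Z f g h"
proof -
  have "f \<in> arr D" using assms by (simp add: Hom_iff)
  then obtain g h where gh: "(f, g, h) \<in> triangles D" using triangle_exists by blast
  from triangle_of_triangles[OF gh] show ?thesis using that assms by (auto simp: Hom_iff)
qed

text \<open>The cone \<open>W\<close> of \<open>g\<close> has to be a shift before rotating back,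
  but \<Sigma>\<Sigma>^-1 W is only isomorphic to \<open>W\<close>. The triangle is therefore moved
  along this isomorphism first.\<close>

lemma triangle_onto:
  assumes g: "g \<in> Hom D Y Z"
  obtains X f h where "triangle D X Y Z f g h"
proof -
  obtain W a b where T: "triangle D Y Z W g a b" using triangle_on[OF g] by blast
  note ab = triangleD[OF T]
  let ?X = "unshift_obj D W"
  obtain s t where s: "s \<in> Hom D (shift_obj D ?X) W" and t: "t \<in> Hom D W (shift_obj D ?X)"
    and ts: "t \<cdot> s = idn D (shift_obj D ?X)" and st: "s \<cdot> t = idn D W"
    using shift_unshift_iso[OF ab(6)] by blast
  have X: "?X \<in> obj D" using unshift_obj_obj ab(6) .
  note bs = compose_hom[OF s ab(3)]
  \<comment> \<open>With this sign the third map of the rotated triangle becomes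
    \<open>b \<cdot> s\<close>.\<close>
  obtain f where f: "f \<in> Hom D ?X Y" "shift_arr D f = neg_arr D (b \<cdot> s)"
    using shift_full[OF neg_Hom[OF bs] X ab(4)] by blast
  note ta = compose_hom[OF ab(2) t]
  have "triangle D Y Z (shift_obj D ?X) g (t \<cdot> a) (b \<cdot> s)"
  proof (rule triangle_isomorphic[OF T g ta bs])
    show "idn D Y \<in> Hom D Y Y" "is_iso D (idn D Y)" "idn D Z \<in> Hom D Z Z" "is_iso D (idn D Z)"
      using ab(4,5) by (simp_all add: idn_hom is_iso_idn)
    show "t \<in> Hom D W (shift_obj D ?X)" "is_iso D t" using t is_isoI[OF t s st ts] by auto
    show "idn D Z \<cdot> g = g \<cdot> idn D Y" using idl[OF g] idr[OF g] by simp
    show "t \<cdot> a = t \<cdot> a \<cdot> idn D Z" using idr[OF ta] by simp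
    show "shift_arr D (idn D Y) \<cdot> b = b \<cdot> s \<cdot> t"
      using compose_assoc[OF t s ab(3)] st idr[OF ab(3)] idl[OF ab(3)] shift_idn[OF ab(4)] by simp
  qed
  then have "triangle D ?X Y Z f g (t \<cdot> a)"
    unfolding triangle_rotate_iff[OF f(1) g ta] f(2) neg_neg[OF bs] .
  then show ?thesis by (rule that)
qed

section \<open>Associativity of \<open>star\<close> from the octahedral axiom\<close>

lemma octahedron:
  assumes F: "triangle D X Y Z' f f' f''" and G: "triangle D Y Z X' g g' g''"
    and H: "triangle D X Z Y' (g \<cdot> f) h' h''"
  obtains u v w where "triangle D Z' Y' X' u v w"
proof -
  note f = triangleD[OF F] and g = triangleD[OF G] and h = triangleD[OF H]
  have "tgt D f = src D g" using f g by (simp add: Hom_iff)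
  from octahedral[OF this] F G H
  obtain u v where uv: "u \<in> Hom D (tgt D f') (tgt D h')" "v \<in> Hom D (tgt D h') (tgt D g')"
    "(u, v, shift_arr D f' \<cdot> g'') \<in> triangles D"
    unfolding triangle_def by blast
  have "u \<in> Hom D Z' Y'" "v \<in> Hom D Y' X'" "shift_arr D f' \<cdot> g'' \<in> Hom D X' (shift_obj D Z')"
    using uv(1,2) f(2) h(2) g(2) compose_hom[OF g(3) shift_Hom[OF f(2)]] by (auto simp: Hom_iff)
  then show ?thesis using that uv(3) by (simp add: triangle_def)
qed

text \<open>For A -> N -> B and N -> M -> C, the new middle term \<open>K\<close> is the cone of the
  composite A -> N -> M; the octahedron exhibits it as an extension B -> K -> C.\<close>

lemma star_assoc_subset1: "star D (star D X Y) Z \<subseteq> star D X (star D Y Z)"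
proof
  fix M assume "M \<in> star D (star D X Y) Z"
  then obtain N C A B f g h f' g' h' where
      T: "triangle D N M C f g h" "triangle D A N B f' g' h'" and ABC: "A \<in> X" "B \<in> Y" "C \<in> Z"
    by (auto simp: star_iff)
  have "f \<cdot> f' \<in> Hom D A M" using compose_hom triangleD(1) T by blast
  then obtain K k k' where K: "triangle D A M K (f \<cdot> f') k k'" using triangle_on by blast
  obtain u v w where "triangle D B K C u v w" using octahedron[OF T(2,1) K] by blast
  from starI[OF K ABC(1) starI[OF this ABC(2,3)]] show "M \<in> star D X (star D Y Z)" .
qed

text \<open>Here \<open>K\<close> is the fibre of the composite M -> N -> C. The octahedral axiom
  speaks of cones, so it is applied to the rotated triangles; the result \<Sigma>A -> \<Sigma>K ->
  \<Sigma>B is then desuspended.\<close>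

lemma star_assoc_subset2: "star D X (star D Y Z) \<subseteq> star D (star D X Y) Z"
proof
  fix M assume "M \<in> star D X (star D Y Z)"
  then obtain N A B C f g h f' g' h' where
      T: "triangle D A M N f g h" "triangle D B N C f' g' h'" and ABC: "A \<in> X" "B \<in> Y" "C \<in> Z"
    by (auto simp: star_iff)
  have "g' \<cdot> g \<in> Hom D M C" using compose_hom triangleD(2) T by blast
  then obtain K k k' where K: "triangle D K M C k (g' \<cdot> g) k'" using triangle_onto by blast
  obtain u v w where "triangle D (shift_obj D A) (shift_obj D K) (shift_obj D B) u v w"
    using octahedron[OF triangle_rotated[OF T(1)] triangle_rotated[OF T(2)] triangle_rotated[OF K]]
    by blast
  then obtain u' v' w' where "triangle D A K B u' v' w'"
    using triangle_unshift[OF _ triangleD(4)[OF T(1)] triangleD(4)[OF K] triangleD(4)[OF T(2)]]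
    by blast
  from starI[OF K starI[OF this ABC(1,2)] ABC(3)] show "M \<in> star D (star D X Y) Z" .
qed


section \<open>Vanishing of morphisms and extensions\<close>

lemma hom_vanishes_mono:
  "\<lbrakk>hom_vanishes D X Y; X' \<subseteq> X; Y' \<subseteq> Y\<rbrakk> \<Longrightarrow> hom_vanishes D X' Y'"
  unfolding hom_vanishes_def by blast

lemma hom_vanishesI:
  assumes "X \<subseteq> obj D" "Y \<subseteq> obj D"
    and "\<And>A B f. \<lbrakk>A \<in> X; B \<in> Y; f \<in> Hom D A B\<rbrakk> \<Longrightarrow> f = zero_arr D A B"
  shows "hom_vanishes D X Y"
  using hom_vanishes_iff[OF assms(1,2)] assms(3) by blast

text \<open>Half-exactness of D(-, W): a map out of \<open>M\<close> that dies on \<open>A\<close>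
  comes from \<open>B\<close>.\<close>

lemma hom_vanishes_middle_left:
  assumes T: "triangle D A M B f g h" and Z: "Z \<subseteq> obj D"
    and van: "hom_vanishes D {A} Z" "hom_vanishes D {B} Z"
  shows "hom_vanishes D {M} Z"
proof (rule hom_vanishesI)
  note fgh = triangleD[OF T]
  show "{M} \<subseteq> obj D" using fgh by simp
  fix N W k assume "N \<in> {M}" and W: "W \<in> Z" and k': "k \<in> Hom D N W"
  then have k: "k \<in> Hom D M W" and [simp]: "N = M" by simp_all
  have "k \<cdot> f = zero_arr D A W"
    using hom_vanishesD[OF van(1) _ W compose_hom[OF fgh(1) k]] by simp
  from triangle_factor[OF T k this] obtain l where l: "l \<in> Hom D B W" "l \<cdot> g = k" by blast
  then show "k = zero_arr D N W"
    using hom_vanishesD[OF van(2) _ W l(1)] compose_zero_left[OF fgh(2)] Hom_obj[OF k] by simp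
qed (rule Z)

lemma hom_vanishes_middle_right:
  assumes T: "triangle D A M B f g h" and Z: "Z \<subseteq> obj D"
    and van: "hom_vanishes D Z {A}" "hom_vanishes D Z {B}"
  shows "hom_vanishes D Z {M}"
proof (rule hom_vanishesI)
  note fgh = triangleD[OF T]
  show "{M} \<subseteq> obj D" using fgh by simp
  fix W N k assume W: "W \<in> Z" and "N \<in> {M}" and k': "k \<in> Hom D W N"
  then have k: "k \<in> Hom D W M" and [simp]: "N = M" by simp_all
  have "g \<cdot> k = zero_arr D W B"
    using hom_vanishesD[OF van(2) W _ compose_hom[OF k fgh(2)]] by simp
  from triangle_lift[OF T k this] obtain l where l: "l \<in> Hom D W A" "f \<cdot> l = k" by blast
  then show "k = zero_arr D W N"
    using hom_vanishesD[OF van(1) W _ l(1)] compose_zero_right[OF fgh(1)] Hom_obj[OF k] by simp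
qed (rule Z)

text \<open>The kernel of D(W, A) -> D(W, B) is a quotient of D(W, \<Sigma>^-1 C), whose vanishing
  is expressed as D(\<Sigma>W, C) = 0.\<close>

lemma hom_vanishes_fibre:
  assumes T: "triangle D A B C f g h" and Z: "Z \<subseteq> obj D"
    and van: "hom_vanishes D Z {B}" "hom_vanishes D (shift_obj D ` Z) {C}"
  shows "hom_vanishes D Z {A}"
proof (rule hom_vanishesI)
  note fgh = triangleD[OF T]
  show "{A} \<subseteq> obj D" using fgh by simp
  fix W N k assume W: "W \<in> Z" and "N \<in> {A}" and k': "k \<in> Hom D W N"
  then have k: "k \<in> Hom D W A" and [simp]: "N = A" by simp_all
  have Wo: "W \<in> obj D" using W Z by blast
  have vC: "\<forall>l \<in> Hom D (shift_obj D W) C. l = zero_arr D (shift_obj D W) C"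
    using hom_vanishesD[OF van(2)] W by blast
  have "f \<cdot> k = f \<cdot> zero_arr D W A"
    using hom_vanishesD[OF van(1) W _ compose_hom[OF k fgh(1)]] compose_zero_right[OF fgh(1) Wo]
    by simp
  from triangle_lift_unique[OF T vC k zero_Hom[OF Wo fgh(4)] this]
  show "k = zero_arr D W N" by simp
qed (rule Z)

lemma hom_vanishes_star_left:
  assumes "Z \<subseteq> obj D" "hom_vanishes D X Z" "hom_vanishes D Y Z"
  shows "hom_vanishes D (star D X Y) Z"
proof -
  have "hom_vanishes D {M} Z" if M: "M \<in> star D X Y" for M
  proof -
    obtain A B f g h where "A \<in> X" "B \<in> Y" and T: "triangle D A M B f g h"
      using M by (auto simp: star_iff)
    with assms show ?thesis
      by (intro hom_vanishes_middle_left[OF T]) (auto intro: hom_vanishes_mono)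
  qed
  then show ?thesis unfolding hom_vanishes_def by blast
qed

lemma hom_vanishes_star_right:
  assumes "Z \<subseteq> obj D" "hom_vanishes D Z X" "hom_vanishes D Z Y"
  shows "hom_vanishes D Z (star D X Y)"
proof -
  have "hom_vanishes D Z {M}" if M: "M \<in> star D X Y" for M
  proof -
    obtain A B f g h where "A \<in> X" "B \<in> Y" and T: "triangle D A M B f g h"
      using M by (auto simp: star_iff)
    with assms show ?thesis
      by (intro hom_vanishes_middle_right[OF T]) (auto intro: hom_vanishes_mono)
  qed
  then show ?thesis unfolding hom_vanishes_def by blast
qed

lemma star_subset_obj: "star D X Y \<subseteq> obj D"
  by (auto simp: star_def)

text \<open>An isomorphism at the middle term is absorbed into the two adjacent maps, and the end
  terms stay the same.\<close>

lemma star_subcategory: "is_subcategory D (star D X Y)"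
  unfolding is_subcategory_def
proof (intro conjI allI impI)
  fix b assume b: "is_iso D b \<and> src D b \<in> star D X Y"
  let ?M = "src D b" and ?N = "tgt D b"
  have bH: "b \<in> Hom D ?M ?N" using b by (simp add: is_iso_def Hom_iff)
  then obtain c where c: "c \<in> Hom D ?N ?M" "c \<cdot> b = idn D ?M" "b \<cdot> c = idn D ?N"
    using b is_isoE by blast
  obtain A B f g h where AB: "A \<in> X" "B \<in> Y" and T: "triangle D A ?M B f g h"
    using b by (auto simp: star_iff)
  note fgh = triangleD[OF T]
  have "triangle D A ?N B (b \<cdot> f) (g \<cdot> c) h"
  proof (rule triangle_isomorphic[OF T compose_hom[OF fgh(1) bH] compose_hom[OF c(1) fgh(2)] fgh(3)])
    show "idn D A \<in> Hom D A A" "is_iso D (idn D A)" using fgh(4) by (simp_all add: idn_hom is_iso_idn)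
    show "b \<in> Hom D ?M ?N" "is_iso D b" using bH b by simp_all
    show "idn D B \<in> Hom D B B" "is_iso D (idn D B)" using fgh(6) by (simp_all add: idn_hom is_iso_idn)
    show "b \<cdot> f = b \<cdot> f \<cdot> idn D A" using idr[OF compose_hom[OF fgh(1) bH]] by simp
    show "idn D B \<cdot> g = g \<cdot> c \<cdot> b"
      using compose_assoc[OF bH c(1) fgh(2)] c(2) idl[OF fgh(2)] idr[OF fgh(2)] by simp
    show "shift_arr D (idn D A) \<cdot> h = h \<cdot> idn D B"
      using idl[OF fgh(3)] idr[OF fgh(3)] shift_idn[OF fgh(4)] by simp
  qed
  from starI[OF this AB] show "?N \<in> star D X Y" .
qed (rule star_subset_obj)

lemma shift_star: "shift_obj D ` star D X Y \<subseteq> star D (shift_obj D ` X) (shift_obj D ` Y)"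
proof (rule image_subsetI)
  fix M assume "M \<in> star D X Y"
  then obtain A B f g h where "A \<in> X" "B \<in> Y" and T: "triangle D A M B f g h"
    by (auto simp: star_iff)
  with triangle_rotate3_iff[OF triangleD(1-3)[OF T]] starI
  show "shift_obj D M \<in> star D (shift_obj D ` X) (shift_obj D ` Y)" by blast
qed

lemma subset_star_left:
  assumes "is_zero_object D Z" "Z \<in> X" "Y \<subseteq> obj D"
  shows "Y \<subseteq> star D X Y"
  using triangle_zero_idn[OF _ assms(1)] starI assms(2,3) by blast

lemma subset_star_right:
  assumes "is_zero_object D Z" "Z \<in> Y" "X \<subseteq> obj D"
  shows "X \<subseteq> star D X Y"
  using triangle_idn_zero[OF _ assms(1)] starI assms(2,3) by blast

lemma star_left_perp:
  assumes M: "M \<in> star D X Y" and van: "hom_vanishes D {M} Y" "hom_vanishes D (shift_obj D ` X) Y"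
    and X: "is_subcategory D X"
  shows "M \<in> X"
proof -
  obtain A B f g h where AB: "A \<in> X" "B \<in> Y" and T: "triangle D A M B f g h"
    using M by (auto simp: star_iff)
  have "g = zero_arr D M B" using hom_vanishesD[OF van(1) _ AB(2)] triangleD(2)[OF T] by blast
  from triangle_second_zero_iso[OF T this] hom_vanishesD[OF van(2) _ AB(2)] AB(1)
  have "is_iso D f" by blast
  from subcategory_iso[OF X this triangleD(1)[OF T]] show ?thesis using AB(1) by blast
qed

text \<open>The dual needs the same condition D(\<Sigma>X, Y) = 0: uniqueness of lifts along the
  first map for sources in \<open>X\<close> and uniqueness of factorizations through the second map
  for targets in \<open>Y\<close> are both governed by maps \<Sigma>X -> Y.\<close>

lemma star_right_perp:
  assumes M: "M \<in> star D X Y" and van: "hom_vanishes D X {M}" "hom_vanishes D (shift_obj D ` X) Y"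
    and Y: "is_subcategory D Y"
  shows "M \<in> Y"
proof -
  obtain A B f g h where AB: "A \<in> X" "B \<in> Y" and T: "triangle D A M B f g h"
    using M by (auto simp: star_iff)
  have "f = zero_arr D A M" using hom_vanishesD[OF van(1) AB(1)] triangleD(1)[OF T] by blast
  from triangle_first_zero_iso[OF T this] hom_vanishesD[OF van(2) _ AB(2)] AB(1)
  have "is_iso D g" by blast
  from subcategory_iso[OF Y this triangleD(2)[OF T]] show ?thesis using AB(2) by blast
qed

section \<open>t-structures and s-torsion pairs\<close>

lemma is_subcategory_Int: "\<lbrakk>is_subcategory D X; is_subcategory D Y\<rbrakk> \<Longrightarrow> is_subcategory D (X \<inter> Y)"
  unfolding is_subcategory_def by blast

lemma t_structureD:
  assumes "t_structure D (U, V)"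
  shows "is_subcategory D U" "is_subcategory D V" "star D U V = obj D" "hom_vanishes D U V"
    "shift_obj D ` U \<subseteq> U" "U \<subseteq> obj D" "V \<subseteq> obj D" "hom_vanishes D (shift_obj D ` U) V"
proof -
  show U: "is_subcategory D U" "is_subcategory D V" "star D U V = obj D" "hom_vanishes D U V"
    "shift_obj D ` U \<subseteq> U" using assms by (simp_all add: t_structure_def)
  then show "U \<subseteq> obj D" "V \<subseteq> obj D" by (simp_all add: is_subcategory_def)
  show "hom_vanishes D (shift_obj D ` U) V" using U hom_vanishes_mono by blast
qed

text \<open>From \<Sigma>U \<subseteq> U comes D(\<Sigma>U, V) = 0, so orthogonality to
  \<open>V\<close> detects the aisle. Its closure under extensions and cones rests on this.\<close>

lemma aisle_iff:
  assumes "t_structure D (U, V)"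
  shows "M \<in> U \<longleftrightarrow> M \<in> obj D \<and> hom_vanishes D {M} V"
  using star_left_perp[of M U V] t_structureD[OF assms] hom_vanishes_mono[of U V "{M}" V] by blast

lemma coaisle_iff:
  assumes "t_structure D (U, V)"
  shows "M \<in> V \<longleftrightarrow> M \<in> obj D \<and> hom_vanishes D U {M}"
  using star_right_perp[of M U V] t_structureD[OF assms] hom_vanishes_mono[of U V U "{M}"] by blast

lemma aisle_extension:
  assumes "t_structure D (U, V)" "triangle D A M B f g h" "A \<in> U" "B \<in> U"
  shows "M \<in> U"
  using assms hom_vanishes_middle_left[OF assms(2) t_structureD(7)[OF assms(1)]] triangleD(5)[OF assms(2)]
  unfolding aisle_iff[OF assms(1)] by blast

lemma coaisle_extension:
  assumes "t_structure D (U, V)" "triangle D A M B f g h" "A \<in> V" "B \<in> V"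
  shows "M \<in> V"
  using assms hom_vanishes_middle_right[OF assms(2) t_structureD(6)[OF assms(1)]] triangleD(5)[OF assms(2)]
  unfolding coaisle_iff[OF assms(1)] by blast

text \<open>Rotation makes the cone \<open>C\<close> an extension B -> C -> \<Sigma>A of two objects
  of the aisle.\<close>

lemma aisle_cone:
  assumes "t_structure D (U, V)" "triangle D A B C f g h" "A \<in> U" "B \<in> U"
  shows "C \<in> U"
  using aisle_extension[OF assms(1) triangle_rotated[OF assms(2)] assms(4)]
    t_structureD(5)[OF assms(1)] assms(3) by blast

text \<open>Closure of \<open>V\<close> under \<Sigma>^-1 enters in the form D(\<Sigma>U, V) =
  0.\<close>

lemma coaisle_fibre:
  assumes T: "t_structure D (U, V)" "triangle D A B C f g h" and "B \<in> V" "C \<in> V"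
  shows "A \<in> V"
proof -
  note t = t_structureD[OF T(1)]
  have "hom_vanishes D U {B}" "hom_vanishes D (shift_obj D ` U) {C}"
    using hom_vanishes_mono[OF t(4), of U "{B}"] hom_vanishes_mono[OF t(8), of _ "{C}"] assms(3,4)
    by blast+
  from hom_vanishes_fibre[OF T(2) t(6) this] show ?thesis
    using triangleD(4)[OF T(2)] coaisle_iff[OF T(1)] by blast
qed

lemma star_aisle_subset:
  "\<lbrakk>t_structure D (U, V); X \<subseteq> U; Y \<subseteq> U\<rbrakk> \<Longrightarrow> star D X Y \<subseteq> U"
  unfolding star_iff subset_iff by (blast intro: aisle_extension)

lemma star_coaisle_subset:
  "\<lbrakk>t_structure D (U, V); X \<subseteq> V; Y \<subseteq> V\<rbrakk> \<Longrightarrow> star D X Y \<subseteq> V"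
  unfolding star_iff subset_iff by (blast intro: coaisle_extension)

lemma zero_object_hom_vanishes:
  assumes "is_zero_object D Z" "Y \<subseteq> obj D"
  shows "hom_vanishes D {Z} Y" "hom_vanishes D Y {Z}"
  using assms zero_object_Hom_from[OF assms(1)] zero_object_Hom_to[OF assms(1)]
  by (auto intro!: hom_vanishesI simp: zero_object_iff)

lemma zero_object_aisle:
  assumes "t_structure D (U, V)" "is_zero_object D Z"
  shows "Z \<in> U" "Z \<in> V"
  unfolding aisle_iff[OF assms(1)] coaisle_iff[OF assms(1)]
  using zero_object_hom_vanishes[OF assms(2)] t_structureD(6,7)[OF assms(1)] assms(2)
  by (auto simp: zero_object_iff)

text \<open>A larger aisle imposes more orthogonality conditions. Used in both directions, this
  shows that the coaisle is determined by the aisle, hence that the order on t-structures is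
  antisymmetric.\<close>

lemma coaisle_antimono:
  assumes "t_structure D (U, V)" "t_structure D (U', V')" "U \<subseteq> U'"
  shows "V' \<subseteq> V"
proof
  fix M assume "M \<in> V'"
  then show "M \<in> V"
    unfolding coaisle_iff[OF assms(1)] coaisle_iff[OF assms(2)]
    using hom_vanishes_mono[of U' "{M}" U "{M}"] assms(3) by blast
qed

end

lemma partial_order_fst_order:
  assumes "\<And>p q. \<lbrakk>p \<in> P; q \<in> P; fst p = fst q\<rbrakk> \<Longrightarrow> p = q"
  shows "partial_order_on P (fst_order P)"
  unfolding fst_order_def partial_order_on_def preorder_on_def refl_on_def trans_def antisym_def
  using assms by (blast intro: subset_antisym subset_trans)

lemma inverse_poset_isos_fst_orderI:
  assumes "partial_order_on P (fst_order P)" "partial_order_on Q (fst_order Q)"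
    and "\<phi> ` P \<subseteq> Q" "\<psi> ` Q \<subseteq> P"
    and "\<And>p. p \<in> P \<Longrightarrow> \<psi> (\<phi> p) = p" "\<And>q. q \<in> Q \<Longrightarrow> \<phi> (\<psi> q) = q"
    and "\<And>p p'. fst p \<subseteq> fst p' \<Longrightarrow> fst (\<phi> p) \<subseteq> fst (\<phi> p')"
    and "\<And>q q'. fst q \<subseteq> fst q' \<Longrightarrow> fst (\<psi> q) \<subseteq> fst (\<psi> q')"
  shows "inverse_poset_isos P (fst_order P) Q (fst_order Q) \<phi> \<psi>"
  unfolding inverse_poset_isos_def
proof (intro conjI allI impI ballI)
  show "(\<phi> p, \<phi> p') \<in> fst_order Q" if "(p, p') \<in> fst_order P" for p p'
    using that assms(3,7) by (simp add: fst_order_def image_subset_iff)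
  show "(\<psi> q, \<psi> q') \<in> fst_order P" if "(q, q') \<in> fst_order Q" for q q'
    using that assms(4,8) by (simp add: fst_order_def image_subset_iff)
qed (fact assms)+

section \<open>The heart of an interval of t-structures and the two maps\<close>

locale t_structure_interval = triangulated_category D
  for D :: "('o, 'm, 'x) triangulated_cat_scheme" (structure) +
  fixes U1 V1 U2 V2 :: "'o set"
  assumes t1: "t_structure D (U1, V1)" and t2: "t_structure D (U2, V2)" and U12: "U1 \<subseteq> U2"
begin

abbreviation "heart \<equiv> U2 \<inter> V1"

lemmas t1D = t_structureD[OF t1] and t2D = t_structureD[OF t2]

lemma V21: "V2 \<subseteq> V1"
  using coaisle_antimono[OF t1 t2 U12] .

lemma heart_subcategory: "is_subcategory D heart"
  using is_subcategory_Int t1D t2D by blast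

lemma heart_obj: "heart \<subseteq> obj D"
  using t1D by blast

lemma heart_extension:
  "\<lbrakk>triangle D A M B f g h; A \<in> heart; B \<in> heart\<rbrakk> \<Longrightarrow> M \<in> heart"
  using aisle_extension[OF t2] coaisle_extension[OF t1] by blast

lemma zero_object_heart: "is_zero_object D Z \<Longrightarrow> Z \<in> heart"
  using zero_object_aisle t1 t2 by blast

text \<open>Working form of the definition: subcategories of the heart become subcategories of
  \<open>D\<close> contained in it, and the condition with \<Sigma>^-1 becomes one with
  \<Sigma>.\<close>

lemma stors_iff:
  "(X, Y) \<in> stors D heart \<longleftrightarrow> is_subcategory D X \<and> is_subcategory D Y \<and> X \<subseteq> heart \<and> Y \<subseteq> heart \<and>
    heart = star D X Y \<and> hom_vanishes D X Y \<and> hom_vanishes D (shift_obj D ` X) Y"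
proof -
  have "hom_vanishes D X (unshift_obj D ` Y) \<longleftrightarrow> hom_vanishes D (shift_obj D ` X) Y"
    if "X \<subseteq> heart" "Y \<subseteq> heart"
    using hom_vanishes_unshift that heart_obj by blast
  then show ?thesis
    unfolding stors_def is_subcategory_full_subcat_iff[OF heart_subcategory] by auto
qed

lemma storsD:
  assumes "(X, Y) \<in> stors D heart"
  shows "is_subcategory D X" "is_subcategory D Y" "X \<subseteq> heart" "Y \<subseteq> heart"
    "star D X Y = heart" "hom_vanishes D X Y" "hom_vanishes D (shift_obj D ` X) Y"
  using assms unfolding stors_iff by blast+

text \<open>The same perpendicularity argument as for aisles. Here D(\<Sigma>X, Y) = 0 is part of
  the data, since \<open>X\<close> need not be closed under the shift.\<close>

lemma stors_fst_iff:
  assumes "(X, Y) \<in> stors D heart"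
  shows "M \<in> X \<longleftrightarrow> M \<in> heart \<and> hom_vanishes D {M} Y"
  using star_left_perp[of M X Y] storsD[OF assms] hom_vanishes_mono[of X Y "{M}" Y] by blast

lemma stors_snd_iff:
  assumes "(X, Y) \<in> stors D heart"
  shows "M \<in> Y \<longleftrightarrow> M \<in> heart \<and> hom_vanishes D X {M}"
  using star_right_perp[of M X Y] storsD[OF assms] hom_vanishes_mono[of X Y X "{M}"] by blast

lemma zero_object_stors:
  assumes "(X, Y) \<in> stors D heart" "is_zero_object D Z"
  shows "Z \<in> X" "Z \<in> Y"
  unfolding stors_fst_iff[OF assms(1)] stors_snd_iff[OF assms(1)]
  using zero_object_hom_vanishes[OF assms(2)] zero_object_heart[OF assms(2)]
    storsD(3,4)[OF assms(1)] heart_obj by blast+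

lemma t_str_iff:
  "(T, F) \<in> t_str D (U1, V1) (U2, V2) \<longleftrightarrow> t_structure D (T, F) \<and> U1 \<subseteq> T \<and> T \<subseteq> U2"
  by (simp add: t_str_def)

lemma t_str_to_stors:
  assumes "(T, F) \<in> t_str D (U1, V1) (U2, V2)"
  shows "(T \<inter> V1, U2 \<inter> F) \<in> stors D heart"
proof -
  have t: "t_structure D (T, F)" and T: "U1 \<subseteq> T" "T \<subseteq> U2" using assms by (auto simp: t_str_iff)
  note tD = t_structureD[OF t]
  have F: "F \<subseteq> V1" using coaisle_antimono[OF t1 t T(1)] .
  have "heart \<subseteq> star D (T \<inter> V1) (U2 \<inter> F)"
  proof
    fix M assume M: "M \<in> heart"
    then have "M \<in> star D T F" using tD(3) heart_obj by blast
    then obtain A B f g h where AB: "A \<in> T" "B \<in> F" and tri: "triangle D A M B f g h"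
      by (auto simp: star_iff)
    \<comment> \<open>The (T, F)-truncation of an object of the heart stays in the heart:
      \<open>A\<close> is the fibre of M -> B with both ends in \<open>V1\<close>, and
      \<open>B\<close> is the cone of A -> M with both ends in \<open>U2\<close>.\<close>
    have "A \<in> V1" using coaisle_fibre[OF t1 tri] M AB F by blast
    moreover have "B \<in> U2" using aisle_cone[OF t2 tri] M AB T by blast
    ultimately show "M \<in> star D (T \<inter> V1) (U2 \<inter> F)"
      using starI[OF tri, of "T \<inter> V1" "U2 \<inter> F"] AB by simp
  qed
  moreover have "star D (T \<inter> V1) (U2 \<inter> F) \<subseteq> heart"
    using star_aisle_subset[OF t2, of "T \<inter> V1" "U2 \<inter> F"]
      star_coaisle_subset[OF t1, of "T \<inter> V1" "U2 \<inter> F"] T F by blast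
  moreover have "hom_vanishes D (T \<inter> V1) (U2 \<inter> F)"
    using hom_vanishes_mono[OF tD(4), of "T \<inter> V1" "U2 \<inter> F"] by blast
  moreover have "hom_vanishes D (shift_obj D ` (T \<inter> V1)) (U2 \<inter> F)"
    by (rule hom_vanishes_mono[OF tD(8)]) blast+
  ultimately show ?thesis
    unfolding stors_iff using is_subcategory_Int tD(1,2) t1D(2) t2D(1) T F by blast
qed

lemma stors_to_t_str:
  assumes S: "(X, Y) \<in> stors D heart"
  shows "(star D U1 X, star D Y V2) \<in> t_str D (U1, V1) (U2, V2)"
proof -
  note sD = storsD[OF S]
  have Xo: "X \<subseteq> obj D" and Yo: "Y \<subseteq> obj D" using sD heart_obj by blast+
  let ?T = "star D U1 X" and ?F = "star D Y V2"
  obtain Z where Z: "is_zero_object D Z" using zero_object by blast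
  \<comment> \<open>Truncate \<open>M\<close> in \<open>V1\<close> by the larger t-structure; the
    \<open>U2\<close>-part is the fibre of a map between objects of \<open>V1\<close>, hence lies in
    the heart.\<close>
  have 1: "V1 \<subseteq> star D heart V2"
  proof
    fix M assume M: "M \<in> V1"
    then have "M \<in> star D U2 V2" using t2D(3) t1D(7) by blast
    then obtain A B f g h where AB: "A \<in> U2" "B \<in> V2" and tri: "triangle D A M B f g h"
      by (auto simp: star_iff)
    have "A \<in> V1" using coaisle_fibre[OF t1 tri] M AB V21 by blast
    then show "M \<in> star D heart V2"
      using starI[OF tri, of "heart" "V2"] AB by simp
  qed
  have "obj D \<subseteq> star D U1 (star D (star D X Y) V2)"
    using star_mono[OF order_refl 1, of U1] t1D(3) sD(5) by simp
  also have "\<dots> \<subseteq> star D U1 (star D X ?F)"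
    by (intro star_mono star_assoc_subset1 order_refl)
  also have "\<dots> \<subseteq> star D ?T ?F" by (rule star_assoc_subset2)
  finally have TF: "star D ?T ?F = obj D" using star_subset_obj by blast
  \<comment> \<open>Both \<open>Y\<close> and \<open>V2\<close> lie in \<open>V1\<close>, and
    coaisles are extension-closed.\<close>
  have vU: "hom_vanishes D U1 ?F"
    by (rule hom_vanishes_mono[OF t1D(4)]) (use star_coaisle_subset[OF t1, of Y V2] sD(4) V21 in auto)
  have vX: "hom_vanishes D X ?F"
    using hom_vanishes_star_right[OF Xo sD(6)] hom_vanishes_mono[OF t2D(4), of X V2] sD(3) by blast
  have sXU: "shift_obj D ` X \<subseteq> U2" using sD(3) t2D(5) by blast
  then have "hom_vanishes D (shift_obj D ` X) V2" using hom_vanishes_mono[OF t2D(4)] by blast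
  \<comment> \<open>The second vanishing condition on s-torsion pairs enters here, for the part
    \<open>Y\<close> of \<open>?F\<close>; the part \<open>V2\<close> is covered by
    \<Sigma>\<open>X\<close> lying in \<open>U2\<close>.\<close>
  then have vsX: "hom_vanishes D (shift_obj D ` X) ?F"
    using hom_vanishes_star_right[OF _ sD(7)] sXU t2D(6) by blast
  have van: "hom_vanishes D ?T ?F" using hom_vanishes_star_left[OF star_subset_obj vU vX] .
  have svan: "hom_vanishes D (shift_obj D ` ?T) ?F"
    using hom_vanishes_mono[OF hom_vanishes_star_left[OF star_subset_obj
      hom_vanishes_mono[OF vU t1D(5) order_refl] vsX] shift_star order_refl] .
  \<comment> \<open>Shift-closure is read off from orthogonality: every object lies in
    \<open>star D ?T ?F\<close>, and those of \<Sigma>\<open>?T\<close> have no nonzero maps to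
    \<open>?F\<close>. The vanishing \<open>svan\<close> serves twice, for the object itself and as
    the cancellation hypothesis.\<close>
  have "shift_obj D ` ?T \<subseteq> ?T"
  proof
    fix M assume M: "M \<in> shift_obj D ` ?T"
    then have "M \<in> star D ?T ?F" using shift_obj_obj star_subset_obj TF by blast
    moreover have "hom_vanishes D {M} ?F" using hom_vanishes_mono[OF svan, of "{M}" ?F] M by blast
    ultimately show "M \<in> ?T" using star_left_perp[OF _ _ svan star_subcategory] by blast
  qed
  then have "t_structure D (?T, ?F)"
    using TF van by (simp add: t_structure_def star_subcategory)
  moreover have "U1 \<subseteq> ?T"
    using subset_star_right[OF Z zero_object_stors(1)[OF S Z] t1D(6)] .
  moreover have "?T \<subseteq> U2" using star_aisle_subset[OF t2 U12] sD(3) by blast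
  ultimately show ?thesis by (simp add: t_str_iff)
qed

text \<open>Truncate an object of \<open>T\<close> by (U1, V1): its \<open>U1\<close>-part lies in
  \<open>T\<close>, so the \<open>V1\<close>-part is a cone inside \<open>T\<close>. Dually, the
  \<open>U2\<close>-part of an object of \<open>F\<close> is a fibre inside
  \<open>F\<close>.\<close>

lemma t_str_stors_t_str:
  assumes "(T, F) \<in> t_str D (U1, V1) (U2, V2)"
  shows "star D U1 (T \<inter> V1) = T" "star D (U2 \<inter> F) V2 = F"
proof -
  have t: "t_structure D (T, F)" and T: "U1 \<subseteq> T" "T \<subseteq> U2" using assms by (auto simp: t_str_iff)
  note tD = t_structureD[OF t]
  have F: "V2 \<subseteq> F" using coaisle_antimono[OF t t2 T(2)] .
  show "star D U1 (T \<inter> V1) = T"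
  proof (rule subset_antisym)
    show "star D U1 (T \<inter> V1) \<subseteq> T" using star_aisle_subset[OF t T(1)] by blast
    show "T \<subseteq> star D U1 (T \<inter> V1)"
    proof
      fix M assume M: "M \<in> T"
      then have "M \<in> star D U1 V1" using t1D(3) tD(6) by blast
      then obtain A B f g h where AB: "A \<in> U1" "B \<in> V1" and tri: "triangle D A M B f g h"
        by (auto simp: star_iff)
      have "B \<in> T" using aisle_cone[OF t tri] AB M T by blast
      then show "M \<in> star D U1 (T \<inter> V1)"
      using starI[OF tri, of "U1" "T \<inter> V1"] AB by simp
    qed
  qed
  show "star D (U2 \<inter> F) V2 = F"
  proof (rule subset_antisym)
    show "star D (U2 \<inter> F) V2 \<subseteq> F" using star_coaisle_subset[OF t _ F] by blast
    show "F \<subseteq> star D (U2 \<inter> F) V2"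
    proof
      fix M assume M: "M \<in> F"
      then have "M \<in> star D U2 V2" using t2D(3) tD(7) by blast
      then obtain A B f g h where AB: "A \<in> U2" "B \<in> V2" and tri: "triangle D A M B f g h"
        by (auto simp: star_iff)
      have "A \<in> F" using coaisle_fibre[OF t tri] AB M F by blast
      then show "M \<in> star D (U2 \<inter> F) V2"
      using starI[OF tri, of "U2 \<inter> F" "V2"] AB by simp
    qed
  qed
qed

text \<open>An object of \<open>V1\<close> receives no nonzero map from \<open>U1\<close>, so if it
  lies in U1 * X it is isomorphic to its \<open>X\<close>-part. Dually for \<open>U2\<close> and
  \<open>V2\<close>. The inclusions back use zero objects as the trivial end term.\<close>

lemma stors_t_str_stors:
  assumes S: "(X, Y) \<in> stors D heart"
  shows "star D U1 X \<inter> V1 = X" "U2 \<inter> star D Y V2 = Y"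
proof -
  note sD = storsD[OF S]
  have Xo: "X \<subseteq> obj D" and Yo: "Y \<subseteq> obj D" using sD heart_obj by blast+
  obtain Z where Z: "is_zero_object D Z" using zero_object by blast
  show "star D U1 X \<inter> V1 = X"
  proof (rule subset_antisym)
    show "star D U1 X \<inter> V1 \<subseteq> X"
    proof
      fix M assume M: "M \<in> star D U1 X \<inter> V1"
      have "hom_vanishes D U1 {M}" "hom_vanishes D (shift_obj D ` U1) X"
        using hom_vanishes_mono[OF t1D(4), of U1 "{M}"] hom_vanishes_mono[OF t1D(8), of _ X] M sD(3)
        by blast+
      then show "M \<in> X" using star_right_perp[OF _ _ _ sD(1)] M by blast
    qed
    show "X \<subseteq> star D U1 X \<inter> V1"
      using subset_star_left[OF Z zero_object_aisle(1)[OF t1 Z] Xo] sD(3) by blast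
  qed
  show "U2 \<inter> star D Y V2 = Y"
  proof (rule subset_antisym)
    show "U2 \<inter> star D Y V2 \<subseteq> Y"
    proof
      fix M assume M: "M \<in> U2 \<inter> star D Y V2"
      have "shift_obj D ` Y \<subseteq> shift_obj D ` U2" using sD(4) by blast
      then have "hom_vanishes D {M} V2" "hom_vanishes D (shift_obj D ` Y) V2"
        using hom_vanishes_mono[OF t2D(4), of "{M}" V2] hom_vanishes_mono[OF t2D(8)] M
        by blast+
      then show "M \<in> Y" using star_left_perp[OF _ _ _ sD(2)] M by blast
    qed
    show "Y \<subseteq> U2 \<inter> star D Y V2"
      using subset_star_right[OF Z zero_object_aisle(2)[OF t2 Z] Yo] sD(4) by blast
  qed
qed

theorem t_str_stors_poset_isos:
  "inverse_poset_isos
    (t_str D (U1, V1) (U2, V2)) (fst_order (t_str D (U1, V1) (U2, V2)))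
    (stors D heart) (fst_order (stors D heart))
    (\<lambda>(T, F). (T \<inter> V1, U2 \<inter> F)) (\<lambda>(X, Y). (star D U1 X, star D Y V2))"
  (is "inverse_poset_isos _ _ _ _ ?\<phi> ?\<psi>")
proof -
  have "partial_order_on (t_str D (U1, V1) (U2, V2)) (fst_order (t_str D (U1, V1) (U2, V2)))"
  proof (rule partial_order_fst_order)
    fix p q assume "p \<in> t_str D (U1, V1) (U2, V2)" "q \<in> t_str D (U1, V1) (U2, V2)" "fst p = fst q"
    then obtain T F F' where "p = (T, F)" "q = (T, F')" "t_structure D (T, F)" "t_structure D (T, F')"
      by (cases p; cases q) (auto simp: t_str_iff)
    then show "p = q" using coaisle_antimono by blast
  qed
  moreover have "partial_order_on (stors D heart) (fst_order (stors D heart))"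
  proof (rule partial_order_fst_order)
    fix p q assume pq: "p \<in> stors D heart" "q \<in> stors D heart" "fst p = fst q"
    then obtain X Y Y' where "p = (X, Y)" "q = (X, Y')" by (cases p; cases q) auto
    then show "p = q" using stors_snd_iff[of X Y] stors_snd_iff[of X Y'] pq by auto
  qed
  moreover have "?\<phi> ` t_str D (U1, V1) (U2, V2) \<subseteq> stors D heart"
    using t_str_to_stors by (auto simp del: Int_iff)
  moreover have "?\<psi> ` stors D heart \<subseteq> t_str D (U1, V1) (U2, V2)"
    using stors_to_t_str by auto
  moreover have "?\<psi> (?\<phi> p) = p" if "p \<in> t_str D (U1, V1) (U2, V2)" for p
    using t_str_stors_t_str[of "fst p" "snd p"] that by (simp add: case_prod_beta)
  moreover have "?\<phi> (?\<psi> q) = q" if "q \<in> stors D heart" for q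
    using stors_t_str_stors[of "fst q" "snd q"] that by (simp add: case_prod_beta)
  moreover have "fst (?\<phi> p) \<subseteq> fst (?\<phi> p')" if "fst p \<subseteq> fst p'" for p p'
    using that by (auto simp: case_prod_beta)
  moreover have "fst (?\<psi> q) \<subseteq> fst (?\<psi> q')" if "fst q \<subseteq> fst q'" for q q'
    using star_mono[OF order_refl that] by (simp add: case_prod_beta)
  ultimately show ?thesis by (rule inverse_poset_isos_fst_orderI)
qed


section \<open>The exact structure on the heart\<close>

lemma conflations_iff:
  "(f, g) \<in> conflations D H \<longleftrightarrow> (\<exists>A \<in> H. \<exists>B \<in> H. \<exists>C \<in> H. \<exists>h. triangle D A B C f g h)"
proof
  assume "(f, g) \<in> conflations D H"
  then obtain h where "(f, g, h) \<in> triangles D" "src D f \<in> H" "tgt D f \<in> H" "tgt D g \<in> H"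
    by (auto simp: conflations_def)
  then show "\<exists>A \<in> H. \<exists>B \<in> H. \<exists>C \<in> H. \<exists>h. triangle D A B C f g h"
    using triangle_of_triangles by blast
next
  assume "\<exists>A \<in> H. \<exists>B \<in> H. \<exists>C \<in> H. \<exists>h. triangle D A B C f g h"
  then show "(f, g) \<in> conflations D H"
    by (auto simp: conflations_def triangle_def Hom_iff)
qed

lemma conflationE:
  assumes "(f, g) \<in> conflations D heart"
  obtains A B C h where "A \<in> heart" "B \<in> heart" "C \<in> heart" "triangle D A B C f g h"
  using assms conflations_iff by blast

text \<open>Maps out of or into a biproduct are determined by their components, so \<open>P\<close>
  passes the orthogonality tests for \<open>U2\<close> and \<open>V1\<close>. This avoids showing
  that split triangles are distinguished.\<close>

lemma biproduct_heart:
  assumes P: "is_biproduct D A B P i j p q" and A: "A \<in> heart" and B: "B \<in> heart"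
  shows "P \<in> heart"
proof -
  note b = biproductD[OF P]
  have "hom_vanishes D {P} V2"
  proof (rule hom_vanishesI)
    fix M W f assume M: "M \<in> {P}" and W: "W \<in> V2" and "f \<in> Hom D M W"
    then have f: "f \<in> Hom D P W" by simp
    have Wo: "W \<in> obj D" using W t2D(7) by blast
    have "f \<cdot> i = zero_arr D P W \<cdot> i"
      using hom_vanishesD[OF t2D(4) _ W compose_hom[OF b(2) f]] A compose_zero_left[OF b(2) Wo] by simp
    moreover have "f \<cdot> j = zero_arr D P W \<cdot> j"
      using hom_vanishesD[OF t2D(4) _ W compose_hom[OF b(3) f]] B compose_zero_left[OF b(3) Wo] by simp
    ultimately show "f = zero_arr D M W"
      using biproduct_from_eqI[OF P f zero_Hom[OF b(1) Wo]] M by simp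
  qed (use b(1) t2D(7) in auto)
  moreover have "hom_vanishes D U1 {P}"
  proof (rule hom_vanishesI)
    fix W M f assume M: "M \<in> {P}" and W: "W \<in> U1" and "f \<in> Hom D W M"
    then have f: "f \<in> Hom D W P" by simp
    have Wo: "W \<in> obj D" using W t1D(6) by blast
    have "p \<cdot> f = p \<cdot> zero_arr D W P"
      using hom_vanishesD[OF t1D(4) W _ compose_hom[OF f b(4)]] A compose_zero_right[OF b(4) Wo] by simp
    moreover have "q \<cdot> f = q \<cdot> zero_arr D W P"
      using hom_vanishesD[OF t1D(4) W _ compose_hom[OF f b(5)]] B compose_zero_right[OF b(5) Wo] by simp
    ultimately show "f = zero_arr D W M"
      using biproduct_to_eqI[OF P f zero_Hom[OF Wo b(1)]] M by simp
  qed (use b(1) t1D(6) in auto)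
  ultimately show ?thesis using aisle_iff[OF t2] coaisle_iff[OF t1] b(1) by blast
qed

lemma heart_category: "category (full_subcat D heart)"
proof
  fix A assume "A \<in> obj (full_subcat D heart)"
  then show "idn (full_subcat D heart) A \<in> Hom (full_subcat D heart) A A"
    using idn_hom[of A] heart_obj by (auto simp: full_subcat_simps Hom_full_subcat)
next
  fix f X Y g Z
  assume "f \<in> Hom (full_subcat D heart) X Y" "g \<in> Hom (full_subcat D heart) Y Z"
  then show "compose (full_subcat D heart) g f \<in> Hom (full_subcat D heart) X Z"
    using compose_hom[of f X Y g Z] by (simp add: full_subcat_simps Hom_full_subcat split: if_splits)
next
  fix f W X g Y h Z
  assume "f \<in> Hom (full_subcat D heart) W X" "g \<in> Hom (full_subcat D heart) X Y"
    "h \<in> Hom (full_subcat D heart) Y Z"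
  then show "compose (full_subcat D heart) (compose (full_subcat D heart) h g) f =
      compose (full_subcat D heart) h (compose (full_subcat D heart) g f)"
    using compose_assoc[of f W X g Y h Z] by (simp add: full_subcat_simps Hom_full_subcat split: if_splits)
qed (simp_all add: full_subcat_simps idn_left idn_right)

lemma heart_additive: "additive_category (full_subcat D heart)"
proof (intro additive_category.intro heart_category additive_category_axioms.intro)
  fix A B assume "A \<in> obj (full_subcat D heart)" "B \<in> obj (full_subcat D heart)"
  then have A: "A \<in> heart" and B: "B \<in> heart" by (simp_all add: full_subcat_simps)
  have "Defs.hom_group (full_subcat D heart) A B = Defs.hom_group D A B"
    using A B by (simp add: Defs.hom_group_def Hom_full_subcat full_subcat_simps)
  moreover have "A \<in> obj D" "B \<in> obj D" using A B heart_obj by blast+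
  ultimately show "comm_group (Defs.hom_group (full_subcat D heart) A B)"
    using hom_group by simp
  obtain P i j p q where P: "is_biproduct D A B P i j p q"
    using biproducts \<open>A \<in> obj D\<close> \<open>B \<in> obj D\<close> by blast
  then have "is_biproduct (full_subcat D heart) A B P i j p q"
    using biproduct_heart[OF P A B] A B
    by (simp add: is_biproduct_def Hom_full_subcat full_subcat_simps)
  then show "\<exists>P i j p q. is_biproduct (full_subcat D heart) A B P i j p q" by blast
next
  obtain Z where Z: "is_zero_object D Z" using zero_object by blast
  note ZH = zero_object_heart[OF Z]
  have "(\<exists>!f. f \<in> Hom D A Z) \<and> (\<exists>!f. f \<in> Hom D Z A)" if "A \<in> heart" for A
    using Z heart_obj that unfolding is_zero_object_def by blast
  then have "is_zero_object (full_subcat D heart) Z"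
    unfolding is_zero_object_def full_subcat_simps Hom_full_subcat using ZH by simp
  then show "\<exists>Z. is_zero_object (full_subcat D heart) Z" by blast
next
  fix f X Y f' g Z
  assume "f \<in> Hom (full_subcat D heart) X Y" "f' \<in> Hom (full_subcat D heart) X Y"
    "g \<in> Hom (full_subcat D heart) Y Z"
  then show "compose (full_subcat D heart) g (add_arr (full_subcat D heart) f f') =
      add_arr (full_subcat D heart) (compose (full_subcat D heart) g f) (compose (full_subcat D heart) g f')"
    using compose_add_right[of f X Y f' g Z] by (simp add: full_subcat_simps Hom_full_subcat split: if_splits)
next
  fix f X Y g Z g'
  assume "f \<in> Hom (full_subcat D heart) X Y" "g \<in> Hom (full_subcat D heart) Y Z"
    "g' \<in> Hom (full_subcat D heart) Y Z"
  then show "compose (full_subcat D heart) (add_arr (full_subcat D heart) g g') f =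
      add_arr (full_subcat D heart) (compose (full_subcat D heart) g f) (compose (full_subcat D heart) g' f)"
    using compose_add_left[of f X Y g Z g'] by (simp add: full_subcat_simps Hom_full_subcat split: if_splits)
qed

text \<open>These two criteria replace the octahedral axiom in the verification of the exact
  structure: composition and base change of admissible morphisms become diagram chases.\<close>

lemma admissible_monic_iff:
  assumes A: "A \<in> heart" and B: "B \<in> heart" and i: "i \<in> Hom D A B"
  shows "admissible_monic (conflations D heart) i \<longleftrightarrow>
    (\<forall>W \<in> U1. \<forall>w \<in> Hom D W (shift_obj D A).
      shift_arr D i \<cdot> w = zero_arr D W (shift_obj D B) \<longrightarrow> w = zero_arr D W (shift_obj D A))"
    (is "_ \<longleftrightarrow> ?inj")
proof
  assume "admissible_monic (conflations D heart) i"
  then obtain p where "(i, p) \<in> conflations D heart" by (auto simp: admissible_monic_def)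
  then obtain A' B' C h where C: "C \<in> heart" and T': "triangle D A' B' C i p h"
    by (rule conflationE)
  have "A' = A" "B' = B" using triangleD(1)[OF T'] i by (auto simp: Hom_iff)
  then have T: "triangle D A B C i p h" using T' by simp
  show ?inj
  proof (intro ballI impI)
    fix W w assume W: "W \<in> U1" and w: "w \<in> Hom D W (shift_obj D A)"
      and w0: "shift_arr D i \<cdot> w = zero_arr D W (shift_obj D B)"
    obtain l where l: "l \<in> Hom D W C" "h \<cdot> l = w" using triangle_lift_connecting[OF T w w0] by blast
    have "l = zero_arr D W C" using hom_vanishesD[OF t1D(4) W _ l(1)] C by blast
    then show "w = zero_arr D W (shift_obj D A)"
      using l(2) compose_zero_right[OF triangleD(3)[OF T]] W t1D(6) by blast
  qed
next
  assume inj: ?inj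
  obtain C p h where T: "triangle D A B C i p h" using triangle_on[OF i] by blast
  note iph = triangleD[OF T]
  \<comment> \<open>The cone of a map in the aisle \<open>U2\<close> stays there, so only D(U1, C) =
    0 is in question.\<close>
  have "C \<in> U2" using aisle_cone[OF t2 T] A B by blast
  moreover have "hom_vanishes D U1 {C}"
  proof (rule hom_vanishesI)
    fix W M l assume W: "W \<in> U1" and M: "M \<in> {C}" and "l \<in> Hom D W M"
    then have l: "l \<in> Hom D W C" by simp
    have Wo: "W \<in> obj D" using W t1D(6) by blast
    \<comment> \<open>For \<open>l\<close> from \<open>U1\<close> to \<open>C\<close>, the map
      \<open>h \<cdot> l\<close> is killed by \<Sigma>\<open>i\<close>, hence zero by hypothesis. So
      \<open>l\<close> lifts to \<open>B\<close>, where maps from \<open>U1\<close> vanish.\<close>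
    have "shift_arr D i \<cdot> h = zero_arr D C (shift_obj D B)"
      using triangle_compose_zero[OF triangle_rotated[OF triangle_rotated[OF T]]]
        compose_neg_left[OF iph(3) shift_Hom[OF iph(1)]] neg_zero[OF iph(6) shift_obj_obj[OF iph(5)]]
        neg_neg[OF compose_hom[OF iph(3) shift_Hom[OF iph(1)]]] by simp
    then have "shift_arr D i \<cdot> (h \<cdot> l) = zero_arr D W (shift_obj D B)"
      using compose_assoc[OF l iph(3) shift_Hom[OF iph(1)]]
        compose_zero_left[OF l shift_obj_obj[OF iph(5)]] by simp
    then have "h \<cdot> l = zero_arr D W (shift_obj D A)"
      using inj W compose_hom[OF l iph(3)] by blast
    from triangle_lift[OF triangle_rotated[OF T] l this]
    obtain m where m: "m \<in> Hom D W B" "p \<cdot> m = l" by blast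
    have "m = zero_arr D W B" using hom_vanishesD[OF t1D(4) W _ m(1)] B by blast
    then show "l = zero_arr D W M" using m(2) compose_zero_right[OF iph(2) Wo] M by simp
  qed (use iph(6) t1D(6) in auto)
  ultimately have "C \<in> heart" using coaisle_iff[OF t1] iph(6) by blast
  then have "(i, p) \<in> conflations D heart" using conflations_iff T A B by blast
  then show "admissible_monic (conflations D heart) i" by (auto simp: admissible_monic_def)
qed

lemma admissible_epic_iff:
  assumes B: "B \<in> heart" and C: "C \<in> heart" and p: "p \<in> Hom D B C"
  shows "admissible_epic (conflations D heart) p \<longleftrightarrow>
    (\<forall>W \<in> V2. \<forall>w \<in> Hom D C (shift_obj D W).
      w \<cdot> p = zero_arr D B (shift_obj D W) \<longrightarrow> w = zero_arr D C (shift_obj D W))"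
    (is "_ \<longleftrightarrow> ?inj")
proof
  assume "admissible_epic (conflations D heart) p"
  then obtain i where "(i, p) \<in> conflations D heart" by (auto simp: admissible_epic_def)
  then obtain A B' C' h where A: "A \<in> heart" and T': "triangle D A B' C' i p h"
    by (rule conflationE)
  have "B' = B" "C' = C" using triangleD(2)[OF T'] p by (auto simp: Hom_iff)
  then have T: "triangle D A B C i p h" using T' by simp
  show ?inj
  proof (intro ballI impI)
    fix W w assume W: "W \<in> V2" and w: "w \<in> Hom D C (shift_obj D W)"
      and w0: "w \<cdot> p = zero_arr D B (shift_obj D W)"
    have Wo: "W \<in> obj D" using W t2D(7) by blast
    obtain l where l: "l \<in> Hom D (shift_obj D A) (shift_obj D W)" "l \<cdot> h = w"
      using triangle_factor[OF triangle_rotated[OF T] w w0] by blast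
    \<comment> \<open>Fullness of the shift replaces the map \<Sigma>A -> \<Sigma>W by one from
      \<open>A\<close> in \<open>U2\<close> to \<open>W\<close> in \<open>V2\<close>.\<close>
    obtain k where k: "k \<in> Hom D A W" "shift_arr D k = l"
      using shift_full[OF l(1) triangleD(4)[OF T] Wo] by blast
    have "k = zero_arr D A W" using hom_vanishesD[OF t2D(4) _ W k(1)] A by blast
    then have "l = zero_arr D (shift_obj D A) (shift_obj D W)"
      using k(2) shift_zero[OF triangleD(4)[OF T] Wo] by simp
    then show "w = zero_arr D C (shift_obj D W)"
      using l(2) compose_zero_left[OF triangleD(3)[OF T] shift_obj_obj[OF Wo]] by simp
  qed
next
  assume inj: ?inj
  obtain A i h where T: "triangle D A B C i p h" using triangle_onto[OF p] by blast
  note iph = triangleD[OF T]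
  have "A \<in> V1" using coaisle_fibre[OF t1 T] B C by blast
  moreover have "hom_vanishes D {A} V2"
  proof (rule hom_vanishesI)
    fix M W l assume W: "W \<in> V2" and M: "M \<in> {A}" and "l \<in> Hom D M W"
    then have l: "l \<in> Hom D A W" by simp
    have Wo: "W \<in> obj D" using W t2D(7) by blast
    note sl = shift_Hom[OF l]
    \<comment> \<open>For \<open>l\<close> from \<open>A\<close> to \<open>V2\<close>, the map
      \<Sigma>\<open>l\<close> \<open>\<cdot> h\<close> dies on \<open>B\<close>, hence is zero by
      hypothesis. So \<Sigma>\<open>l\<close> extends along \<Sigma>\<open>i\<close> to \<Sigma>B,
      and desuspending leaves a map from \<open>B\<close> to \<open>V2\<close>.\<close>
    have "h \<cdot> p = zero_arr D B (shift_obj D A)"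
      using triangle_compose_zero[OF triangle_rotated[OF T]] .
    then have "shift_arr D l \<cdot> h \<cdot> p = zero_arr D B (shift_obj D W)"
      using compose_assoc[OF iph(2,3) sl] compose_zero_right[OF sl iph(5)] by simp
    then have "shift_arr D l \<cdot> h = zero_arr D C (shift_obj D W)"
      using inj W compose_hom[OF iph(3) sl] by blast
    from triangle_factor_shift[OF T sl this]
    obtain m where m: "m \<in> Hom D (shift_obj D B) (shift_obj D W)" "m \<cdot> shift_arr D i = shift_arr D l"
      by blast
    obtain k where k: "k \<in> Hom D B W" "shift_arr D k = m"
      using shift_full[OF m(1) iph(5) Wo] by blast
    have "k = zero_arr D B W" using hom_vanishesD[OF t2D(4) _ W k(1)] B by blast
    then have "m = zero_arr D (shift_obj D B) (shift_obj D W)"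
      using k(2) shift_zero[OF iph(5) Wo] by simp
    then have "shift_arr D l = zero_arr D (shift_obj D A) (shift_obj D W)"
      using m(2) compose_zero_left[OF shift_Hom[OF iph(1)] shift_obj_obj[OF Wo]] by simp
    from shift_eq_zeroD[OF l this] show "l = zero_arr D M W" using M by simp
  qed (use iph(4) t2D(7) in auto)
  ultimately have "A \<in> heart" using aisle_iff[OF t2] iph(4) by blast
  then have "(i, p) \<in> conflations D heart" using conflations_iff T B C by blast
  then show "admissible_epic (conflations D heart) p" by (auto simp: admissible_epic_def)
qed

lemma admissible_monicD:
  assumes "admissible_monic (conflations D heart) i"
  shows "i \<in> Hom D (src D i) (tgt D i)" "src D i \<in> heart" "tgt D i \<in> heart"
proof -
  obtain p where "(i, p) \<in> conflations D heart" using assms by (auto simp: admissible_monic_def)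
  then obtain A B C h where "A \<in> heart" "B \<in> heart" and T: "triangle D A B C i p h"
    by (rule conflationE)
  then show "i \<in> Hom D (src D i) (tgt D i)" "src D i \<in> heart" "tgt D i \<in> heart"
    using triangleD(1)[OF T] by (simp_all add: Hom_iff)
qed

lemma admissible_epicD:
  assumes "admissible_epic (conflations D heart) p"
  shows "p \<in> Hom D (src D p) (tgt D p)" "src D p \<in> heart" "tgt D p \<in> heart"
proof -
  obtain i where "(i, p) \<in> conflations D heart" using assms by (auto simp: admissible_epic_def)
  then obtain A B C h where "B \<in> heart" "C \<in> heart" and T: "triangle D A B C i p h"
    by (rule conflationE)
  then show "p \<in> Hom D (src D p) (tgt D p)" "src D p \<in> heart" "tgt D p \<in> heart"
    using triangleD(2)[OF T] by (simp_all add: Hom_iff)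
qed

lemma conflations_iso_closed:
  assumes ip: "(i, p) \<in> conflations D heart" and C: "A' \<in> heart" "B' \<in> heart" "C' \<in> heart"
    and ip': "i' \<in> Hom D A' B'" "p' \<in> Hom D B' C'"
    and abc: "a \<in> Hom D (src D i) A'" "b \<in> Hom D (tgt D i) B'" "c \<in> Hom D (tgt D p) C'"
    and iso: "is_iso D a" "is_iso D b" "is_iso D c"
    and eq: "b \<cdot> i = i' \<cdot> a" "c \<cdot> p = p' \<cdot> b"
  shows "(i', p') \<in> conflations D heart"
proof -
  obtain A B C h where T: "triangle D A B C i p h" by (rule conflationE[OF ip])
  note iph = triangleD[OF T]
  have a: "a \<in> Hom D A A'" and b: "b \<in> Hom D B B'" and c: "c \<in> Hom D C C'"
    using abc iph by (simp_all add: Hom_iff)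
  \<comment> \<open>The data contain no connecting map for the new pair; it is built as
    \<Sigma>\<open>a\<close> \<open>\<cdot> h \<cdot> d\<close> with \<open>d\<close> inverting
    \<open>c\<close>.\<close>
  obtain d where d: "d \<in> Hom D C' C" "d \<cdot> c = idn D C" using is_isoE[OF iso(3) c] by blast
  note ah = compose_hom[OF iph(3) shift_Hom[OF a]]
  have "shift_arr D a \<cdot> h = shift_arr D a \<cdot> h \<cdot> d \<cdot> c"
    using compose_assoc[OF c d(1) ah] d(2) idr[OF ah] by simp
  from triangle_isomorphic[OF T ip' compose_hom[OF d(1) ah] a iso(1) b iso(2) c iso(3) eq this]
  show ?thesis using conflations_iff C by blast
qed

lemma admissible_monic_compose:
  assumes i: "admissible_monic (conflations D heart) i" and j: "admissible_monic (conflations D heart) j"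
    and ij: "tgt D i = src D j"
  shows "admissible_monic (conflations D heart) (j \<cdot> i)"
proof -
  define A B C where ABC: "A = src D i" "B = tgt D i" "C = tgt D j"
  have H: "A \<in> heart" "B \<in> heart" "C \<in> heart" and iH: "i \<in> Hom D A B" and jH: "j \<in> Hom D B C"
    using admissible_monicD[OF i] admissible_monicD[OF j] ij ABC by simp_all
  show ?thesis
    unfolding admissible_monic_iff[OF H(1,3) compose_hom[OF iH jH]]
  proof (intro ballI impI)
    fix W w assume W: "W \<in> U1" and w: "w \<in> Hom D W (shift_obj D A)"
      and w0: "shift_arr D (j \<cdot> i) \<cdot> w = zero_arr D W (shift_obj D C)"
    have "shift_arr D j \<cdot> (shift_arr D i \<cdot> w) = zero_arr D W (shift_obj D C)"
      using w0 shift_compose[OF iH jH] compose_assoc[OF w shift_Hom[OF iH] shift_Hom[OF jH]] by simp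
    then have "shift_arr D i \<cdot> w = zero_arr D W (shift_obj D B)"
      using j W compose_hom[OF w shift_Hom[OF iH]] unfolding admissible_monic_iff[OF H(2,3) jH] by blast
    then show "w = zero_arr D W (shift_obj D A)"
      using i W w unfolding admissible_monic_iff[OF H(1,2) iH] by blast
  qed
qed

lemma admissible_epic_compose:
  assumes p: "admissible_epic (conflations D heart) p" and q: "admissible_epic (conflations D heart) q"
    and pq: "tgt D p = src D q"
  shows "admissible_epic (conflations D heart) (q \<cdot> p)"
proof -
  define A B C where ABC: "A = src D p" "B = tgt D p" "C = tgt D q"
  have H: "A \<in> heart" "B \<in> heart" "C \<in> heart" and pH: "p \<in> Hom D A B" and qH: "q \<in> Hom D B C"
    using admissible_epicD[OF p] admissible_epicD[OF q] pq ABC by simp_all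
  show ?thesis
    unfolding admissible_epic_iff[OF H(1,3) compose_hom[OF pH qH]]
  proof (intro ballI impI)
    fix W w assume W: "W \<in> V2" and w: "w \<in> Hom D C (shift_obj D W)"
      and w0: "w \<cdot> (q \<cdot> p) = zero_arr D A (shift_obj D W)"
    have "w \<cdot> q \<cdot> p = zero_arr D A (shift_obj D W)"
      using w0 compose_assoc[OF pH qH w] by simp
    then have "w \<cdot> q = zero_arr D B (shift_obj D W)"
      using p W compose_hom[OF qH w] unfolding admissible_epic_iff[OF H(1,2) pH] by blast
    then show "w = zero_arr D C (shift_obj D W)"
      using q W w unfolding admissible_epic_iff[OF H(2,3) qH] by blast
  qed
qed

lemma admissible_idn:
  assumes A: "A \<in> heart"
  shows "admissible_monic (conflations D heart) (idn D A)" "admissible_epic (conflations D heart) (idn D A)"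
proof -
  have Ao: "A \<in> obj D" using A heart_obj by blast
  obtain Z where Z: "is_zero_object D Z" using zero_object by blast
  have ZH: "Z \<in> heart" using zero_object_heart[OF Z] .
  show "admissible_monic (conflations D heart) (idn D A)"
    using triangle_idn_zero[OF Ao Z] A ZH unfolding admissible_monic_def conflations_iff by blast
  show "admissible_epic (conflations D heart) (idn D A)"
    using triangle_zero_idn[OF Ao Z] A ZH unfolding admissible_epic_def conflations_iff by blast
qed

end

section \<open>Exactness of the heart and torsion pairs when \<Sigma>\<open>U2\<close> lies in
  \<open>U1\<close>\<close>

locale exact_interval = t_structure_interval D U1 V1 U2 V2
  for D :: "('o, 'm, 'x) triangulated_cat_scheme" (structure) and U1 V1 U2 V2 +
  assumes shift_U2: "shift_obj D ` U2 \<subseteq> U1"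
begin

text \<open>The hypothesis \<open>shift_U2\<close> enters only through this vanishing.\<close>

lemma shift_heart_vanishes: "hom_vanishes D (shift_obj D ` heart) heart"
proof -
  have "shift_obj D ` heart \<subseteq> U1" using shift_U2 by blast
  from hom_vanishes_mono[OF t1D(4) this] show ?thesis by blast
qed

lemma Hom_shift_heart:
  assumes "A \<in> heart" "B \<in> heart"
  shows "\<forall>l \<in> Hom D (shift_obj D A) B. l = zero_arr D (shift_obj D A) B"
  using hom_vanishesD[OF shift_heart_vanishes imageI[OF assms(1)] assms(2)] by blast

text \<open>Existence is exactness of the triangle; uniqueness is D(\<Sigma>W, C) = 0. This turns
  the weak kernel given by a triangle into a kernel in the heart.\<close>

lemma conflation_lift:
  assumes T: "triangle D A B C i p h" and H: "A \<in> heart" "B \<in> heart" "C \<in> heart" and W: "W \<in> heart"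
    and f: "f \<in> Hom D W B" "p \<cdot> f = zero_arr D W C"
  shows "\<exists>!k. k \<in> Hom D W A \<and> i \<cdot> k = f"
proof -
  obtain k where k: "k \<in> Hom D W A" "i \<cdot> k = f" using triangle_lift[OF T f] by blast
  show ?thesis
  proof (rule ex1I[of _ k])
    show "k' = k" if "k' \<in> Hom D W A \<and> i \<cdot> k' = f" for k'
      using triangle_lift_unique[OF T Hom_shift_heart[OF W H(3)], of k' k] k that by simp
  qed (use k in blast)
qed

lemma conflation_factor:
  assumes T: "triangle D A B C i p h" and H: "A \<in> heart" "B \<in> heart" "C \<in> heart" and W: "W \<in> heart"
    and f: "f \<in> Hom D B W" "f \<cdot> i = zero_arr D A W"
  shows "\<exists>!k. k \<in> Hom D C W \<and> k \<cdot> p = f"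
proof -
  obtain k where k: "k \<in> Hom D C W" "k \<cdot> p = f" using triangle_factor[OF T f] by blast
  show ?thesis
  proof (rule ex1I[of _ k])
    show "k' = k" if "k' \<in> Hom D C W \<and> k' \<cdot> p = f" for k'
      using triangle_factor_unique[OF T Hom_shift_heart[OF H(1) W], of k' k] k that by simp
  qed (use k in blast)
qed

lemma conflation_kernel_cokernel:
  assumes "(i, p) \<in> conflations D heart"
  shows "is_kernel (full_subcat D heart) i p" "is_cokernel (full_subcat D heart) p i"
proof -
  obtain A B C h where H: "A \<in> heart" "B \<in> heart" "C \<in> heart" and T: "triangle D A B C i p h"
    using assms by (rule conflationE)
  have i: "i \<in> arr D" "src D i = A" "tgt D i = B" and p: "p \<in> arr D" "src D p = B" "tgt D p = C"
    using triangleD(1,2)[OF T] by (simp_all add: Hom_iff)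
  have pi: "p \<cdot> i = zero_arr D A C" using triangle_compose_zero[OF T] .
  show "is_kernel (full_subcat D heart) i p"
    unfolding is_kernel_def full_subcat_simps Hom_full_subcat i p
  proof (intro conjI ballI impI)
    fix f assume f: "f \<in> {f \<in> arr D. src D f \<in> heart \<and> tgt D f \<in> heart}"
      "tgt D f = B \<and> p \<cdot> f = zero_arr D (src D f) C"
    then have W: "src D f \<in> heart" and fH: "f \<in> Hom D (src D f) B" by (simp_all add: Hom_iff)
    show "\<exists>!k. k \<in> (if src D f \<in> heart \<and> A \<in> heart then Hom D (src D f) A else {}) \<and> i \<cdot> k = f"
      using conflation_lift[OF T H W fH] f(2) W H(1) by simp
  qed (use i p pi H in simp_all)
  show "is_cokernel (full_subcat D heart) p i"
    unfolding is_cokernel_def full_subcat_simps Hom_full_subcat i p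
  proof (intro conjI ballI impI)
    fix f assume f: "f \<in> {f \<in> arr D. src D f \<in> heart \<and> tgt D f \<in> heart}"
      "src D f = B \<and> f \<cdot> i = zero_arr D A (tgt D f)"
    then have W: "tgt D f \<in> heart" and fH: "f \<in> Hom D B (tgt D f)" by (simp_all add: Hom_iff)
    show "\<exists>!k. k \<in> (if C \<in> heart \<and> tgt D f \<in> heart then Hom D C (tgt D f) else {}) \<and> k \<cdot> p = f"
      using conflation_factor[OF T H W fH] f(2) W H(3) by simp
  qed (use i p pi H in simp_all)
qed

text \<open>The pushout is the cokernel of \<open>(i, - f) : A \<rightarrow> B \<oplus> A'\<close>.\<close>

lemma admissible_monic_pushout:
  assumes adm: "admissible_monic (conflations D heart) i" and H: "A \<in> heart" "B \<in> heart" "A' \<in> heart"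
    and i: "i \<in> Hom D A B" and f: "f \<in> Hom D A A'"
  shows "\<exists>i' f'. is_pushout (full_subcat D heart) i f i' f' \<and> admissible_monic (conflations D heart) i'"
proof -
  have Ho: "A \<in> obj D" "B \<in> obj D" "A' \<in> obj D" using H heart_obj by blast+
  obtain P x y u v where P: "is_biproduct D B A' P x y u v"
    using biproducts Ho by blast
  note b = biproductD[OF P]
  have PH: "P \<in> heart" using biproduct_heart[OF P H(2,3)] .
  note xi = compose_hom[OF i b(2)] and yf = compose_hom[OF f b(3)]
  define s where "s = sub_arr D (x \<cdot> i) (y \<cdot> f)"
  have s: "s \<in> Hom D A P" using sub_Hom[OF xi yf] by (simp add: s_def)
  have "u \<cdot> s = sub_arr D (u \<cdot> (x \<cdot> i)) (u \<cdot> (y \<cdot> f))"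
    unfolding s_def using compose_sub_right[OF xi yf b(4)] .
  also have "\<dots> = sub_arr D i (zero_arr D A B)"
    using compose_assoc[OF i b(2,4)] compose_assoc[OF f b(3,4)] b(6,9) idl[OF i]
      compose_zero_left[OF f Ho(2)] by simp
  also have "\<dots> = i"
    by (simp add: sub_arr_def neg_zero Ho add_zero_right[OF i])
  finally have us: "u \<cdot> s = i" .
  \<comment> \<open>Because \<open>u \<cdot> s = i\<close>, whatever \<Sigma>\<open>s\<close> kills
    is killed by \<Sigma>\<open>i\<close>; the injectivity criterion passes from \<open>i\<close> to
    \<open>s\<close>, so the cone \<open>Q\<close> of \<open>s\<close> lies in the heart.\<close>
  have adms: "admissible_monic (conflations D heart) s"
    unfolding admissible_monic_iff[OF H(1) PH s]
  proof (intro ballI impI)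
    fix W w assume W: "W \<in> U1" and w: "w \<in> Hom D W (shift_obj D A)"
      and w0: "shift_arr D s \<cdot> w = zero_arr D W (shift_obj D P)"
    have "W \<in> obj D" using W t1D(6) by blast
    then have "shift_arr D i \<cdot> w = zero_arr D W (shift_obj D B)"
      using compose_assoc[OF w shift_Hom[OF s] shift_Hom[OF b(4)]] w0 us
        shift_compose[OF s b(4)] compose_zero_right[OF shift_Hom[OF b(4)]] by simp
    then show "w = zero_arr D W (shift_obj D A)"
      using adm W w unfolding admissible_monic_iff[OF H(1,2) i] by blast
  qed
  then obtain c where "(s, c) \<in> conflations D heart" by (auto simp: admissible_monic_def)
  then obtain A0 P0 Q h where Q: "Q \<in> heart" and T0: "triangle D A0 P0 Q s c h" by (rule conflationE)
  have "A0 = A" "P0 = P" using triangleD(1)[OF T0] s by (auto simp: Hom_iff)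
  then have T: "triangle D A P Q s c h" using T0 by simp
  note c = triangleD(2)[OF T]
  note i' = compose_hom[OF b(3) c] and f' = compose_hom[OF b(2) c]
  have "sub_arr D (c \<cdot> (x \<cdot> i)) (c \<cdot> (y \<cdot> f)) = zero_arr D A Q"
    using triangle_compose_zero[OF T] compose_sub_right[OF xi yf c] by (simp add: s_def)
  then have square: "c \<cdot> y \<cdot> f = c \<cdot> x \<cdot> i"
    using sub_eq_zero_iff[OF compose_hom[OF xi c] compose_hom[OF yf c]]
      compose_assoc[OF i b(2) c] compose_assoc[OF f b(3) c] by simp
  \<comment> \<open>A compatible pair (d, a) is a map \<open>m\<close> out of \<open>P\<close> with
    \<open>m \<cdot> s = 0\<close>, and such maps factor uniquely through the cokernel
    \<open>c\<close>.\<close>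
  have univ: "\<exists>!k. k \<in> Hom D Q R \<and> k \<cdot> (c \<cdot> y) = a \<and> k \<cdot> (c \<cdot> x) = d"
    if R: "R \<in> heart" and a: "a \<in> Hom D A' R" and d: "d \<in> Hom D B R" and ad: "a \<cdot> f = d \<cdot> i" for R a d
  proof -
    obtain m where m: "m \<in> Hom D P R" "m \<cdot> x = d" "m \<cdot> y = a" using biproduct_copair[OF P d a] by blast
    have "m \<cdot> s = sub_arr D (m \<cdot> (x \<cdot> i)) (m \<cdot> (y \<cdot> f))"
      unfolding s_def using compose_sub_right[OF xi yf m(1)] .
    also have "\<dots> = zero_arr D A R"
      using compose_assoc[OF i b(2) m(1)] compose_assoc[OF f b(3) m(1)] m(2,3) ad
        sub_eq_zero_iff[OF compose_hom[OF i d] compose_hom[OF i d]] by simp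
    finally have ms: "m \<cdot> s = zero_arr D A R" .
    have "k \<cdot> c = m \<longleftrightarrow> k \<cdot> (c \<cdot> y) = a \<and> k \<cdot> (c \<cdot> x) = d" if k: "k \<in> Hom D Q R" for k
      using biproduct_from_eqI[OF P compose_hom[OF c k] m(1)] m(2,3)
        compose_assoc[OF b(2) c k] compose_assoc[OF b(3) c k] by auto
    then show ?thesis using conflation_factor[OF T H(1) PH Q R m(1) ms] by (metis (no_types, lifting))
  qed
  have "is_pushout (full_subcat D heart) i f (c \<cdot> y) (c \<cdot> x)"
  proof -
    have ends: "i \<in> arr D" "src D i = A" "tgt D i = B" "f \<in> arr D" "src D f = A" "tgt D f = A'"
      "c \<cdot> y \<in> arr D" "src D (c \<cdot> y) = A'" "tgt D (c \<cdot> y) = Q"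
      "c \<cdot> x \<in> arr D" "src D (c \<cdot> x) = B" "tgt D (c \<cdot> x) = Q"
      using i f i' f' by (simp_all add: Hom_iff)
    show ?thesis
      unfolding is_pushout_def full_subcat_simps Hom_full_subcat ends mem_Collect_eq
      using H Q square univ ends(1,4,7,10) by simp
  qed
  \<comment> \<open>If \<Sigma>\<open>(c \<cdot> y)\<close> kills \<open>w\<close>, then
    \<Sigma>\<open>y\<close> \<open>\<cdot> w\<close> is \<Sigma>\<open>s\<close>
    \<open>\<cdot> t\<close> for some \<open>t\<close>. Projecting with \<open>u\<close> gives
    \<Sigma>\<open>i\<close> \<open>\<cdot> t = 0\<close>, as \<open>u \<cdot> y = 0\<close>, so
    \<open>t = 0\<close>; projecting with \<open>v\<close> then recovers
    \<open>w = 0\<close>.\<close>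
  moreover have "admissible_monic (conflations D heart) (c \<cdot> y)"
    unfolding admissible_monic_iff[OF H(3) Q i']
  proof (intro ballI impI)
    fix W w assume W: "W \<in> U1" and w: "w \<in> Hom D W (shift_obj D A')"
      and w0: "shift_arr D (c \<cdot> y) \<cdot> w = zero_arr D W (shift_obj D Q)"
    have Wo: "W \<in> obj D" using W t1D(6) by blast
    note sy = shift_Hom[OF b(3)] and su = shift_Hom[OF b(4)] and sv = shift_Hom[OF b(5)]
    note yw = compose_hom[OF w sy]
    have "shift_arr D c \<cdot> (shift_arr D y \<cdot> w) = zero_arr D W (shift_obj D Q)"
      using w0 shift_compose[OF b(3) c] compose_assoc[OF w sy shift_Hom[OF c]] by simp
    from triangle_lift_shift[OF T yw this]
    obtain t where t: "t \<in> Hom D W (shift_obj D A)" "shift_arr D s \<cdot> t = shift_arr D y \<cdot> w" by blast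
    have "shift_arr D i \<cdot> t = shift_arr D u \<cdot> (shift_arr D s \<cdot> t)"
      using us shift_compose[OF s b(4)] compose_assoc[OF t(1) shift_Hom[OF s] su] by simp
    also have "\<dots> = shift_arr D (u \<cdot> y) \<cdot> w"
      using t(2) compose_assoc[OF w sy su] shift_compose[OF b(3,4)] by simp
    also have "\<dots> = zero_arr D W (shift_obj D B)"
      using b(9) shift_zero[OF Ho(3,2)] compose_zero_left[OF w shift_obj_obj[OF Ho(2)]] by simp
    finally have "t = zero_arr D W (shift_obj D A)"
      using adm W t(1) unfolding admissible_monic_iff[OF H(1,2) i] by blast
    then have "shift_arr D y \<cdot> w = zero_arr D W (shift_obj D P)"
      using t(2) compose_zero_right[OF shift_Hom[OF s] Wo] by simp
    then have "shift_arr D (v \<cdot> y) \<cdot> w = zero_arr D W (shift_obj D A')"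
      using shift_compose[OF b(3,5)] compose_assoc[OF w sy sv] compose_zero_right[OF sv Wo] by simp
    then show "w = zero_arr D W (shift_obj D A')"
      using b(7) shift_idn[OF Ho(3)] idl[OF w] by simp
  qed
  ultimately show ?thesis by blast
qed

text \<open>The pullback is the kernel of \<open>(p, - f) : B \<oplus> C' \<rightarrow> C\<close>.\<close>

lemma admissible_epic_pullback:
  assumes adm: "admissible_epic (conflations D heart) p" and H: "B \<in> heart" "C \<in> heart" "C' \<in> heart"
    and p: "p \<in> Hom D B C" and f: "f \<in> Hom D C' C"
  shows "\<exists>p' f'. is_pullback (full_subcat D heart) p f p' f' \<and> admissible_epic (conflations D heart) p'"
proof -
  have Ho: "B \<in> obj D" "C \<in> obj D" "C' \<in> obj D" using H heart_obj by blast+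
  obtain P x y u v where P: "is_biproduct D B C' P x y u v"
    using biproducts Ho by blast
  note b = biproductD[OF P]
  have PH: "P \<in> heart" using biproduct_heart[OF P H(1,3)] .
  note pu = compose_hom[OF b(4) p] and fv = compose_hom[OF b(5) f]
  define s where "s = sub_arr D (p \<cdot> u) (f \<cdot> v)"
  have s: "s \<in> Hom D P C" using sub_Hom[OF pu fv] by (simp add: s_def)
  have "s \<cdot> x = sub_arr D (p \<cdot> u \<cdot> x) (f \<cdot> v \<cdot> x)"
    unfolding s_def using compose_sub_left[OF b(2) pu fv] .
  also have "\<dots> = sub_arr D p (zero_arr D B C)"
    using compose_assoc[OF b(2,4) p] compose_assoc[OF b(2,5) f] b(6,8) idr[OF p]
      compose_zero_right[OF f Ho(1)] by simp
  also have "\<dots> = p"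
    by (simp add: sub_arr_def neg_zero Ho add_zero_right[OF p])
  finally have sx: "s \<cdot> x = p" .
  \<comment> \<open>Because \<open>s \<cdot> x = p\<close>, a map that kills \<open>s\<close> kills
    \<open>p\<close>; the criterion passes from \<open>p\<close> to \<open>s\<close>, so the fibre
    \<open>K\<close> lies in the heart.\<close>
  have adms: "admissible_epic (conflations D heart) s"
    unfolding admissible_epic_iff[OF PH H(2) s]
  proof (intro ballI impI)
    fix W w assume W: "W \<in> V2" and w: "w \<in> Hom D C (shift_obj D W)"
      and w0: "w \<cdot> s = zero_arr D P (shift_obj D W)"
    have "shift_obj D W \<in> obj D" using W t2D(7) shift_obj_obj by blast
    then have "w \<cdot> p = zero_arr D B (shift_obj D W)"
      using compose_assoc[OF b(2) s w] w0 sx compose_zero_left[OF b(2)] by simp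
    then show "w = zero_arr D C (shift_obj D W)"
      using adm W w unfolding admissible_epic_iff[OF H(1,2) p] by blast
  qed
  then obtain c where "(c, s) \<in> conflations D heart" by (auto simp: admissible_epic_def)
  then obtain K P0 C0 h where K: "K \<in> heart" and T0: "triangle D K P0 C0 c s h" by (rule conflationE)
  have "P0 = P" "C0 = C" using triangleD(2)[OF T0] s by (auto simp: Hom_iff)
  then have T: "triangle D K P C c s h" using T0 by simp
  note c = triangleD(1)[OF T]
  note p' = compose_hom[OF c b(5)] and f' = compose_hom[OF c b(4)]
  have "sub_arr D (p \<cdot> u \<cdot> c) (f \<cdot> v \<cdot> c) = zero_arr D K C"
    using triangle_compose_zero[OF T] compose_sub_left[OF c pu fv] by (simp add: s_def)
  then have square: "f \<cdot> (v \<cdot> c) = p \<cdot> (u \<cdot> c)"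
    using sub_eq_zero_iff[OF compose_hom[OF c pu] compose_hom[OF c fv]]
      compose_assoc[OF c b(4) p] compose_assoc[OF c b(5) f] by simp
  have univ: "\<exists>!k. k \<in> Hom D R K \<and> v \<cdot> c \<cdot> k = a \<and> u \<cdot> c \<cdot> k = d"
    if R: "R \<in> heart" and a: "a \<in> Hom D R C'" and d: "d \<in> Hom D R B" and ad: "f \<cdot> a = p \<cdot> d" for R a d
  proof -
    obtain m where m: "m \<in> Hom D R P" "u \<cdot> m = d" "v \<cdot> m = a" using biproduct_pair[OF P d a] by blast
    have "s \<cdot> m = sub_arr D (p \<cdot> u \<cdot> m) (f \<cdot> v \<cdot> m)"
      unfolding s_def using compose_sub_left[OF m(1) pu fv] .
    also have "\<dots> = zero_arr D R C"
      using compose_assoc[OF m(1) b(4) p] compose_assoc[OF m(1) b(5) f] m(2,3) ad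
        sub_eq_zero_iff[OF compose_hom[OF d p] compose_hom[OF d p]] by simp
    finally have sm: "s \<cdot> m = zero_arr D R C" .
    have "c \<cdot> k = m \<longleftrightarrow> v \<cdot> c \<cdot> k = a \<and> u \<cdot> c \<cdot> k = d" if k: "k \<in> Hom D R K" for k
      using biproduct_to_eqI[OF P compose_hom[OF k c] m(1)] m(2,3)
        compose_assoc[OF k c b(4)] compose_assoc[OF k c b(5)] by auto
    then show ?thesis using conflation_lift[OF T K PH H(2) R m(1) sm] by (metis (no_types, lifting))
  qed
  have "is_pullback (full_subcat D heart) p f (v \<cdot> c) (u \<cdot> c)"
  proof -
    have ends: "p \<in> arr D" "src D p = B" "tgt D p = C" "f \<in> arr D" "src D f = C'" "tgt D f = C"
      "v \<cdot> c \<in> arr D" "src D (v \<cdot> c) = K" "tgt D (v \<cdot> c) = C'"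
      "u \<cdot> c \<in> arr D" "src D (u \<cdot> c) = K" "tgt D (u \<cdot> c) = B"
      using p f p' f' by (simp_all add: Hom_iff)
    show ?thesis
      unfolding is_pullback_def full_subcat_simps Hom_full_subcat ends mem_Collect_eq
      using H K square univ ends(1,4,7,10) by simp
  qed
  \<comment> \<open>If \<open>w\<close> kills \<open>v \<cdot> c\<close>, then
    \<open>w \<cdot> v = t \<cdot> s\<close> for some \<open>t\<close>. Restricting along
    \<open>x\<close> gives \<open>t \<cdot> p = 0\<close>, as \<open>v \<cdot> x = 0\<close>, so
    \<open>t = 0\<close>; restricting along \<open>y\<close> then recovers
    \<open>w = 0\<close>.\<close>
  moreover have "admissible_epic (conflations D heart) (v \<cdot> c)"
    unfolding admissible_epic_iff[OF K H(3) p']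
  proof (intro ballI impI)
    fix W w assume W: "W \<in> V2" and w: "w \<in> Hom D C' (shift_obj D W)"
      and w0: "w \<cdot> (v \<cdot> c) = zero_arr D K (shift_obj D W)"
    have sWo: "shift_obj D W \<in> obj D" using W t2D(7) shift_obj_obj by blast
    note wv = compose_hom[OF b(5) w]
    have "w \<cdot> v \<cdot> c = zero_arr D K (shift_obj D W)"
      using w0 compose_assoc[OF c b(5) w] by simp
    from triangle_factor[OF T wv this]
    obtain t where t: "t \<in> Hom D C (shift_obj D W)" "t \<cdot> s = w \<cdot> v" by blast
    have "t \<cdot> p = w \<cdot> v \<cdot> x"
      using sx compose_assoc[OF b(2) s t(1)] t(2) by simp
    also have "\<dots> = zero_arr D B (shift_obj D W)"
      using compose_assoc[OF b(2,5) w] b(8) compose_zero_right[OF w Ho(1)] by simp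
    finally have "t = zero_arr D C (shift_obj D W)"
      using adm W t(1) unfolding admissible_epic_iff[OF H(1,2) p] by blast
    then have "w \<cdot> v = zero_arr D P (shift_obj D W)"
      using t(2) compose_zero_left[OF s sWo] by simp
    then have "w \<cdot> (v \<cdot> y) = zero_arr D C' (shift_obj D W)"
      using compose_assoc[OF b(3,5) w] compose_zero_left[OF b(3) sWo] by simp
    then show "w = zero_arr D C' (shift_obj D W)"
      using b(7) idr[OF w] by simp
  qed
  ultimately show ?thesis by blast
qed

theorem heart_exact: "exact_category (full_subcat D heart) (conflations D heart)"
proof (intro exact_category.intro heart_additive exact_category_axioms.intro,
    unfold full_subcat_simps Hom_full_subcat iso_full_subcat)
  show "is_kernel (full_subcat D heart) i p \<and> is_cokernel (full_subcat D heart) p i"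
    if "(i, p) \<in> conflations D heart" for i p
    using conflation_kernel_cokernel[OF that] by blast
next
  fix i p i' p' a b c
  assume ip: "(i, p) \<in> conflations D heart"
    and i': "i' \<in> {f \<in> arr D. src D f \<in> heart \<and> tgt D f \<in> heart}"
    and p': "p' \<in> {f \<in> arr D. src D f \<in> heart \<and> tgt D f \<in> heart}"
    and ip': "tgt D i' = src D p'"
    and abc: "a \<in> (if src D i \<in> heart \<and> src D i' \<in> heart then Hom D (src D i) (src D i') else {})"
      "b \<in> (if tgt D i \<in> heart \<and> tgt D i' \<in> heart then Hom D (tgt D i) (tgt D i') else {})"
      "c \<in> (if tgt D p \<in> heart \<and> tgt D p' \<in> heart then Hom D (tgt D p) (tgt D p') else {})"
    and iso: "is_iso D a \<and> src D a \<in> heart \<and> tgt D a \<in> heart"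
      "is_iso D b \<and> src D b \<in> heart \<and> tgt D b \<in> heart"
      "is_iso D c \<and> src D c \<in> heart \<and> tgt D c \<in> heart"
    and eq: "b \<cdot> i = i' \<cdot> a" "c \<cdot> p = p' \<cdot> b"
  show "(i', p') \<in> conflations D heart"
  proof (rule conflations_iso_closed[OF ip])
    show "i' \<in> Hom D (src D i') (tgt D i')" "p' \<in> Hom D (tgt D i') (tgt D p')"
      using i' p' ip' by (simp_all add: Hom_iff)
    show "a \<in> Hom D (src D i) (src D i')" "b \<in> Hom D (tgt D i) (tgt D i')"
      "c \<in> Hom D (tgt D p) (tgt D p')"
      using abc by (simp_all split: if_splits)
  qed (use i' p' iso eq in auto)
next
  show "\<exists>i' f'. is_pushout (full_subcat D heart) i f i' f' \<and> admissible_monic (conflations D heart) i'"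
    if i: "admissible_monic (conflations D heart) i"
      and f: "f \<in> {f \<in> arr D. src D f \<in> heart \<and> tgt D f \<in> heart}" "src D f = src D i" for i f
    using admissible_monic_pushout[OF i admissible_monicD(2,3)[OF i] _ admissible_monicD(1)[OF i]] f
      arr_Hom[of f] by auto
  show "\<exists>p' f'. is_pullback (full_subcat D heart) p f p' f' \<and> admissible_epic (conflations D heart) p'"
    if p: "admissible_epic (conflations D heart) p"
      and f: "f \<in> {f \<in> arr D. src D f \<in> heart \<and> tgt D f \<in> heart}" "tgt D f = tgt D p" for p f
    using admissible_epic_pullback[OF p admissible_epicD(2,3)[OF p] _ admissible_epicD(1)[OF p]] f
      arr_Hom[of f] by auto
qed (fact admissible_idn admissible_monic_compose admissible_epic_compose)+

text \<open>Besides the second vanishing condition, the two notions differ in that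
  \<open>stors\<close> asks for H = X * Y while \<open>tors\<close> asks only that every object of H
  decompose. Extension-closure of the heart supplies the other inclusion.\<close>

theorem stors_eq_tors: "stors D heart = tors (full_subcat D heart) (conflations D heart)"
proof -
  have tors: "(X, Y) \<in> tors (full_subcat D heart) (conflations D heart) \<longleftrightarrow>
      (is_subcategory D X \<and> X \<subseteq> heart) \<and> (is_subcategory D Y \<and> Y \<subseteq> heart) \<and>
      (\<forall>E \<in> heart. \<exists>i p. (i, p) \<in> conflations D heart \<and>
        src D i \<in> X \<and> tgt D i = E \<and> tgt D p \<in> Y) \<and>
      hom_vanishes (full_subcat D heart) X Y" for X Y
    unfolding tors_def full_subcat_simps is_subcategory_full_subcat_iff[OF heart_subcategory]
    by (simp only: mem_Collect_eq prod.case)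
  have "(X, Y) \<in> stors D heart \<longleftrightarrow> (X, Y) \<in> tors (full_subcat D heart) (conflations D heart)" for X Y
  proof (cases "X \<subseteq> heart \<and> Y \<subseteq> heart")
    case True
    then have X: "X \<subseteq> heart" and Y: "Y \<subseteq> heart" by simp_all
    have "hom_vanishes D (shift_obj D ` X) Y"
      by (rule hom_vanishes_mono[OF shift_heart_vanishes]) (use X Y in auto)
    moreover have "hom_vanishes (full_subcat D heart) X Y \<longleftrightarrow> hom_vanishes D X Y"
      unfolding hom_vanishes_def Hom_full_subcat full_subcat_simps using X Y by (simp add: subset_iff)
    moreover have "heart = star D X Y \<longleftrightarrow> (\<forall>E \<in> heart. \<exists>i p. (i, p) \<in> conflations D heart \<and>
        src D i \<in> X \<and> tgt D i = E \<and> tgt D p \<in> Y)" (is "_ \<longleftrightarrow> ?r")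
    proof
      assume star: "heart = star D X Y"
      show ?r
      proof
        fix E assume E: "E \<in> heart"
        then have "E \<in> star D X Y" using star by simp
        then obtain A B i p h where AB: "A \<in> X" "B \<in> Y" and T: "triangle D A E B i p h"
          unfolding star_iff by blast
        then have "(i, p) \<in> conflations D heart" using conflations_iff E X Y by blast
        then show "\<exists>i p. (i, p) \<in> conflations D heart \<and> src D i \<in> X \<and> tgt D i = E \<and> tgt D p \<in> Y"
          using triangleD(1,2)[OF T] AB by (auto simp: Hom_iff)
      qed
    next
      assume r: ?r
      show "heart = star D X Y"
      proof (rule subset_antisym; rule subsetI)
        fix E assume "E \<in> heart"
        then obtain i p where ip: "(i, p) \<in> conflations D heart" "src D i \<in> X" "tgt D i = E" "tgt D p \<in> Y"
          using r by blast
        then obtain h where "(i, p, h) \<in> triangles D" by (auto simp: conflations_def)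
        from triangle_of_triangles[OF this] show "E \<in> star D X Y" using ip(2-4) starI by blast
      next
        fix E assume "E \<in> star D X Y"
        then obtain A B i p h where "A \<in> X" "B \<in> Y" "triangle D A E B i p h"
          unfolding star_iff by blast
        then show "E \<in> heart" using heart_extension X Y by blast
      qed
    qed
    ultimately show ?thesis unfolding stors_iff tors by blast
  next
    \<comment> \<open>Both notions contain the inclusions of \<open>X\<close> and \<open>Y\<close>
      in the heart, so neither holds.\<close>
    case False
    then show ?thesis unfolding stors_iff tors by blast
  qed
  then show ?thesis by auto
qed

end

theorem corollary3p14:
  fixes D :: "('o, 'm, 'x) triangulated_cat_scheme"
    and U\<^sub>1 V\<^sub>1 U\<^sub>2 V\<^sub>2 H :: "'o set"
  assumes "triangulated_category D"
    and "t_structure D (U\<^sub>1, V\<^sub>1)"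
    and "t_structure D (U\<^sub>2, V\<^sub>2)"
    and "U\<^sub>1 \<subseteq> U\<^sub>2"
    and "H = U\<^sub>2 \<inter> V\<^sub>1"
  shows "inverse_poset_isos
           (t_str D (U\<^sub>1, V\<^sub>1) (U\<^sub>2, V\<^sub>2)) (fst_order (t_str D (U\<^sub>1, V\<^sub>1) (U\<^sub>2, V\<^sub>2)))
           (stors D H) (fst_order (stors D H))
           (\<lambda>(T, F). (T \<inter> V\<^sub>1, U\<^sub>2 \<inter> F))
           (\<lambda>(X, Y). (star D U\<^sub>1 X, star D Y V\<^sub>2)) \<and>
         (shift_obj D ` U\<^sub>2 \<subseteq> U\<^sub>1 \<longrightarrow>
            exact_category (full_subcat D H) (conflations D H) \<and>
            stors D H = tors (full_subcat D H) (conflations D H))"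
proof -
  have I: "t_structure_interval D U\<^sub>1 V\<^sub>1 U\<^sub>2 V\<^sub>2"
    using assms(1-4) by (simp add: t_structure_interval_def t_structure_interval_axioms_def)
  have "exact_interval D U\<^sub>1 V\<^sub>1 U\<^sub>2 V\<^sub>2" if "shift_obj D ` U\<^sub>2 \<subseteq> U\<^sub>1"
    using I that by (simp add: exact_interval_def exact_interval_axioms_def)
  then show ?thesis
    unfolding assms(5)
    by (intro conjI impI t_structure_interval.t_str_stors_poset_isos[OF I]
      exact_interval.heart_exact exact_interval.stors_eq_tors)
qed

end
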